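(* Fix $p\in\mathbb C$ with $0<|p|<1$ and an integer $n\ge1$. Fix a basis $\psi_1,\psi_2,\psi_3$ of $V_1$ and put $\Psi_1(t_1,t_2,t_3)=\det_{1\le i,j\le 3}(\psi_j(t_i))$, and $$\Psi_n(t_1,\dots,t_n,u_1,\dots,u_n,v)=\frac{\prod_{i,j=1}^nu_j^{-3}\theta(u_j^3t_i^{\pm3};p^6)}{\theta(v,\pm pv;p^2)^{n-1}}\det_{1\le i,j\le n}\left(\frac{\Psi_1(t_i,u_j,v)}{u_j^{-3}\theta(u_j^3t_i^{\pm3};p^6)}\right).$$ Let $(\psi^{(n)}_j)_{j=1}^{2n+1}$ be a basis of $V_n$. Then, writing $(t_1,\dots,t_{2n+1})=(t_1,\dots,t_n,u_1,\dots,u_n,v)$, there is a constant $C$ independent of all $t_i$ such that $$\Psi_n(t_1,\dots,t_{2n+1})=C\det_{1\le i,j\le 2n+1}\big(\psi_j^{(n)}(t_i)\big).$$ In particular, $\Psi_n$ is antisymmetric in all $2n+1$ variables.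
   Context: Let $\theta(x;p)=\prod_{j=0}^\infty(1-p^jx)(1-p^{j+1}/x)$, with the conventions $\theta(a_1,\dots,a_k;p)=\theta(a_1;p)\cdots\theta(a_k;p)$, $\theta(xy^{\pm};p)=\theta(xy;p)\theta(xy^{-1};p)$, $\theta(v,\pm pv;p^2)=\theta(v;p^2)\theta(pv;p^2)\theta(-pv;p^2)$. Let $\omega=e^{2\pi i/3}$. For $n\ge 1$, let $V_n$ be the complex vector space of holomorphic functions $f$ on $\mathbb C^*=\mathbb C\setminus\{0\}$ satisfying $f(p^2x)=p^{-2(3n+1)}x^{-(6n+3)}f(x)$, $f(x^{-1})=-x^{-1}f(x)$ (i.e. $BC_{3n+1}$ theta functions of nome $p^2$) and $\sum_{k=0}^2\omega^kf(\omega^kx)=0$. The space $V_n$ has dimension $2n+1$. *)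

theory Defs
  imports
    "HOL-Complex_Analysis.Complex_Analysis"
    "HOL-Library.Function_Algebras"
    "Jordan_Normal_Form.Determinant"
begin

hide_const (open) Determinants.det

definition jtheta :: "complex \<Rightarrow> complex \<Rightarrow> complex" where
  "jtheta x p = (\<Prod>j. (1 - p ^ j * x) * (1 - p ^ (j + 1) / x))"

text \<open>The complex vector space of all functions \<open>complex \<Rightarrow> complex\<close> under pointwise operations.\<close>

definition fun_scale :: "complex \<Rightarrow> (complex \<Rightarrow> complex) \<Rightarrow> complex \<Rightarrow> complex" where
  "fun_scale c f = (\<lambda>x. c * f x)"

global_interpretation cfun: vector_space fun_scale
  by unfold_locales (auto simp: fun_scale_def fun_eq_iff algebra_simps)

definition basis_family :: "(complex \<Rightarrow> complex) set \<Rightarrow> nat \<Rightarrow> (nat \<Rightarrow> complex \<Rightarrow> complex) \<Rightarrow> bool" where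
  "basis_family V m b \<longleftrightarrow>
     inj_on b {..<m} \<and> cfun.independent (b ` {..<m}) \<and> cfun.span (b ` {..<m}) = V"

text \<open>
  A function on the punctured plane is represented by the total function that takes the
  value \<open>0\<close> at the origin; without this normalisation, members agreeing on the punctured plane
  could differ at \<open>0\<close>, and the space would have the wrong dimension.
\<close>

definition theta_space :: "complex \<Rightarrow> nat \<Rightarrow> (complex \<Rightarrow> complex) set" where
  "theta_space p n = {f. f holomorphic_on (- {0}) \<and> f 0 = 0 \<and>
     (\<forall>x. x \<noteq> 0 \<longrightarrow>
        f (p ^ 2 * x) = p powi (- 2 * (3 * int n + 1)) * x powi (- (6 * int n + 3)) * f x \<and>
        f (inverse x) = - inverse x * f x \<and>
        (\<Sum>k\<le>2. exp (2 * pi * \<i> / 3) ^ k * f (exp (2 * pi * \<i> / 3) ^ k * x)) = 0)}"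

definition Psi1 :: "(nat \<Rightarrow> complex \<Rightarrow> complex) \<Rightarrow> complex \<Rightarrow> complex \<Rightarrow> complex \<Rightarrow> complex" where
  "Psi1 \<psi> t1 t2 t3 = det (mat 3 3 (\<lambda>(i, j). \<psi> j ([t1, t2, t3] ! i)))"

definition tu_factor :: "complex \<Rightarrow> complex \<Rightarrow> complex \<Rightarrow> complex" where
  "tu_factor p t u =
     u powi (- 3) * (jtheta (u ^ 3 * t ^ 3) (p ^ 6) * jtheta (u ^ 3 * t powi (- 3)) (p ^ 6))"

definition v_factor :: "complex \<Rightarrow> complex \<Rightarrow> complex" where
  "v_factor p v = jtheta v (p ^ 2) * jtheta (p * v) (p ^ 2) * jtheta (- p * v) (p ^ 2)"

definition Psi_formula ::
  "complex \<Rightarrow> (nat \<Rightarrow> complex \<Rightarrow> complex) \<Rightarrow> nat \<Rightarrow>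
   (nat \<Rightarrow> complex) \<Rightarrow> (nat \<Rightarrow> complex) \<Rightarrow> complex \<Rightarrow> complex" where
  "Psi_formula p \<psi> n t u v =
     (\<Prod>i<n. \<Prod>j<n. tu_factor p (t i) (u j)) / v_factor p v ^ (n - 1) *
     det (mat n n (\<lambda>(i, j). Psi1 \<psi> (t i) (u j) v / tu_factor p (t i) (u j)))"

text \<open>
  A point \<open>x\<close> lists the variables as \<open>(t\<^sub>0,\<dots>,t\<^sub>n\<^sub>-\<^sub>1,u\<^sub>0,\<dots>,u\<^sub>n\<^sub>-\<^sub>1,v)\<close>; only \<open>x i\<close> with
  \<open>i < 2 * n + 1\<close> matters.
\<close>

definition punctured_points :: "nat \<Rightarrow> (nat \<Rightarrow> complex) set" where
  "punctured_points n = {x. \<forall>i<2 * n + 1. x i \<noteq> 0}"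

definition regular_points :: "complex \<Rightarrow> nat \<Rightarrow> (nat \<Rightarrow> complex) set" where
  "regular_points p n = {x \<in> punctured_points n.
     v_factor p (x (2 * n)) ^ (n - 1) \<noteq> 0 \<and>
     (\<forall>i<n. \<forall>j<n. tu_factor p (x i) (x (n + j)) \<noteq> 0)}"

text \<open>
  The defining formula has removable singularities where one of its denominators vanishes.
  There the value is the limit from the points where no denominator vanishes.
\<close>

definition Psi :: "complex \<Rightarrow> (nat \<Rightarrow> complex \<Rightarrow> complex) \<Rightarrow> nat \<Rightarrow> (nat \<Rightarrow> complex) \<Rightarrow> complex" where
  "Psi p \<psi> n x =
     (let F = (\<lambda>y. Psi_formula p \<psi> n y (\<lambda>j. y (n + j)) (y (2 * n)))
      in if x \<in> regular_points p n then F x else Lim (at x within regular_points p n) F)"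

end

theory Submission
  imports Defs
begin

text \<open>
  Let \<open>w(v) = \<theta>(v, \<plusminus>pv; p\<^sup>2)\<close> and let \<open>G\<^sub>n = w(v)\<^sup>n\<^sup>-\<^sup>1 \<Psi>\<^sub>n\<close>. Absorbing the product into the rows of the
  determinant shows that \<open>G\<^sub>n\<close> is holomorphic and lies in \<open>V\<^sub>n\<close> as a function of each \<open>t\<^sub>i\<close>.
  The trace condition in the variable \<open>v\<close> is not visible, so antisymmetry under \<open>u\<^sub>i \<leftrightarrow> v\<close> is proved
  first, by induction on \<open>n\<close>. Consider
  \<open>S = G\<^sub>n(t,u,v) w(u\<^sub>i)\<^sup>n\<^sup>-\<^sup>1 + G\<^sub>n(t,u,v)|\<^bsub>u\<^sub>i \<leftrightarrow> v\<^esub> w(v)\<^sup>n\<^sup>-\<^sup>1\<close> as a function of \<open>t\<^sub>n\<close>. It lies in \<open>V\<^sub>n\<close> and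
  vanishes at \<open>u\<^sub>j\<close> and \<open>\<omega>u\<^sub>j\<close> for \<open>j \<noteq> i\<close>: at \<open>t\<^sub>n = \<omega>u\<^sub>j\<close> the determinant collapses to
  \<open>G\<^sub>n\<^sub>-\<^sub>1\<close> times \<open>\<Psi>\<^sub>1(\<omega>u\<^sub>j,u\<^sub>j,v)\<close>, which is a multiple of \<open>w(v) \<theta>(u\<^sub>j\<^sup>3v\<^sup>\<plusminus>\<^sup>3; p\<^sup>6)\<close> because \<open>V\<^sub>0\<close> is
  spanned by \<open>w\<close>. Hence \<open>S\<close> is \<open>\<Prod>\<^bsub>j \<noteq> i\<^esub> \<theta>(u\<^sub>j\<^sup>3t\<^sub>n\<^sup>\<plusminus>\<^sup>3; p\<^sup>6)\<close> times an element of \<open>V\<^sub>1\<close> that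
  vanishes at the three points \<open>u\<^sub>i\<close>, \<open>v\<close>, \<open>t\<^sub>1\<close>, and is therefore zero. Together with the symmetry
  exchanging all \<open>t\<close> with all \<open>u\<close> this gives full antisymmetry, and an alternating function that lies in the
  \<open>(2n+1)\<close>-dimensional space \<open>V\<^sub>n\<close> in each variable is a multiple of the determinant.
\<close>

section \<open>The theta function\<close>

text \<open>The \<open>q\<close>-shifted factorial (x; q)_infinity. It is entire in
  \<open>x\<close>, so zeros, holomorphy and shifts of \<open>jtheta\<close> are reduced to
  it.\<close>

definition qfac :: "complex \<Rightarrow> complex \<Rightarrow> complex" where
  "qfac q x = (\<Prod>j. 1 - q ^ j * x)"

lemma convergent_prod_qfac:
  assumes "norm q < 1"
  shows "convergent_prod (\<lambda>j. 1 - q ^ j * (x :: complex))"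
proof (rule abs_convergent_prod_imp_convergent_prod, rule summable_imp_abs_convergent_prod)
  have "summable (\<lambda>j. norm x * norm q ^ j)"
    using assms by (intro summable_mult summable_geometric) auto
  then show "summable (\<lambda>j. norm (1 - q ^ j * x - 1))"
    by (simp add: norm_mult norm_power mult.commute)
qed

lemma qfac_rec:
  assumes "norm q < 1"
  shows "qfac q x = (1 - x) * qfac q (q * x)"
proof -
  have "(\<lambda>j. 1 - q ^ j * x) has_prod ((\<Prod>k<1. 1 - q ^ k * x) * (\<Prod>k. 1 - q ^ (k + 1) * x))"
    by (rule has_prod_ignore_initial_segment'[OF convergent_prod_qfac[OF assms]])
  then show ?thesis
    by (simp add: qfac_def has_prod_iff mult_ac)
qed

lemma qfac_eq_0_iff:
  assumes "norm q < 1"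
  shows "qfac q x = 0 \<longleftrightarrow> (\<exists>j. q ^ j * x = 1)"
proof -
  have "(\<lambda>j. 1 - q ^ j * x) has_prod qfac q x"
    unfolding qfac_def by (rule convergent_prod_has_prod[OF convergent_prod_qfac[OF assms]])
  from has_prod_eq_0_iff[OF this] show ?thesis by auto
qed

text \<open>On a unit ball around any point the factors differ from 1 by at most a geometric
  sequence, so the partial products converge uniformly there.\<close>

lemma holomorphic_qfac:
  assumes "norm q < 1"
  shows "qfac q holomorphic_on UNIV"
proof (rule holomorphic_uniform_sequence[of UNIV "\<lambda>N x. \<Prod>j<N. 1 - q ^ j * x"])
  fix x :: complex
  let ?f = "\<lambda>N x. \<Prod>j<N. 1 - q ^ j * x" and ?A = "cball x 1"
  have "uniformly_convergent_on ?A ?f"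
  proof (rule uniformly_convergent_on_prod')
    show "uniformly_convergent_on ?A (\<lambda>N x. \<Sum>n<N. norm (1 - q ^ n * x - 1))"
    proof (rule Weierstrass_m_test')
      fix n y assume "y \<in> ?A"
      then have "norm y \<le> norm x + 1"
        using norm_triangle_ineq2[of y x] by (simp add: dist_norm norm_minus_commute)
      then show "norm (norm (1 - q ^ n * y - 1)) \<le> norm q ^ n * (norm x + 1)"
        by (simp add: norm_mult norm_power mult_left_mono)
    next
      show "summable (\<lambda>n. norm q ^ n * (norm x + 1))"
        using assms by (intro summable_mult2 summable_geometric) auto
    qed
  qed (auto intro!: continuous_intros)
  then have "uniform_limit ?A ?f (\<lambda>x. lim (\<lambda>n. ?f n x)) sequentially"
    by (simp add: uniformly_convergent_uniform_limit_iff)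
  also have "?this \<longleftrightarrow> uniform_limit ?A ?f (qfac q) sequentially"
  proof (rule uniform_limit_cong')
    fix y
    have "(\<lambda>n. \<Prod>j\<le>n. 1 - q ^ j * y) \<longlonglongrightarrow> qfac q y"
      unfolding qfac_def by (rule convergent_prod_LIMSEQ[OF convergent_prod_qfac[OF assms]])
    then have "(\<lambda>n. ?f (Suc n) y) \<longlonglongrightarrow> qfac q y"
      by (simp only: lessThan_Suc_atMost)
    then show "lim (\<lambda>n. ?f n y) = qfac q y"
      by (intro limI) (rule LIMSEQ_imp_Suc)
  qed auto
  finally show "\<exists>d>0. cball x d \<subseteq> UNIV \<and> uniform_limit (cball x d) ?f (qfac q) sequentially"
    by (intro exI[of _ 1]) auto
qed (auto intro!: holomorphic_intros)

lemma jtheta_eq_qfac: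
  assumes "norm q < 1"
  shows "jtheta x q = qfac q x * qfac q (q / x)"
proof -
  have "qfac q x * qfac q (q / x) = (\<Prod>j. (1 - q ^ j * x) * (1 - q ^ j * (q / x)))"
    unfolding qfac_def by (intro prodinf_mult convergent_prod_qfac assms)
  then show ?thesis by (simp add: jtheta_def mult_ac)
qed

text \<open>The shift moves one factor between the two products: \<open>1 - x\<close> is lost and
  \<open>1 - 1 / x\<close> is gained, and their ratio is \<open>- inverse x\<close>.\<close>

lemma jtheta_mult_nome:
  assumes "norm q < 1" "q \<noteq> 0" "x \<noteq> 0"
  shows "jtheta (q * x) q = - inverse x * jtheta x q"
proof -
  have "qfac q (1 / x) = (1 - 1 / x) * qfac q (q / x)"
    using qfac_rec[OF assms(1), of "1 / x"] by simp
  then have "jtheta (q * x) q = (1 - 1 / x) * (qfac q (q * x) * qfac q (q / x))"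
    using assms by (simp add: jtheta_eq_qfac inverse_eq_divide)
  also have "(1 - 1 / x) = - inverse x * (1 - x)"
    using assms by (simp add: field_simps)
  finally show ?thesis
    using assms(1) by (simp add: jtheta_eq_qfac qfac_rec[OF assms(1), of x] mult.assoc)
qed

lemma jtheta_inverse:
  assumes "norm q < 1" "x \<noteq> 0"
  shows "jtheta (inverse x) q = - inverse x * jtheta x q"
proof -
  have "qfac q (1 / x) = (1 - 1 / x) * qfac q (q / x)"
    using qfac_rec[OF assms(1), of "1 / x"] by simp
  then have "jtheta (inverse x) q = (1 - 1 / x) * (qfac q (q * x) * qfac q (q / x))"
    using assms by (simp add: jtheta_eq_qfac inverse_eq_divide)
  also have "(1 - 1 / x) = - inverse x * (1 - x)"
    using assms by (simp add: field_simps)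
  finally show ?thesis
    using assms(1) by (simp add: jtheta_eq_qfac qfac_rec[OF assms(1), of x] mult.assoc)
qed

lemma jtheta_div_nome:
  assumes "norm q < 1" "q \<noteq> 0" "x \<noteq> 0"
  shows "jtheta (x / q) q = - (x / q) * jtheta x q"
  using jtheta_mult_nome[of q "x / q"] assms by (simp add: field_simps)

lemma jtheta_eq_0_iff:
  assumes "norm q < 1" "q \<noteq> 0" "x \<noteq> 0"
  shows "jtheta x q = 0 \<longleftrightarrow> (\<exists>k::int. x = q powi k)"
proof
  assume "jtheta x q = 0"
  then consider j where "q ^ j * x = 1" | j where "q ^ j * (q / x) = 1"
    using assms(1) by (auto simp: jtheta_eq_qfac qfac_eq_0_iff)
  then show "\<exists>k::int. x = q powi k"
  proof cases
    case 1
    then have "x = q powi (- int j)"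
      using assms by (simp add: power_int_minus field_simps)
    then show ?thesis by blast
  next
    case 2
    then have "x = q powi (int (Suc j))"
      using assms by (simp only: power_int_of_nat) (simp add: field_simps)
    then show ?thesis by blast
  qed
next
  assume "\<exists>k::int. x = q powi k"
  then obtain k :: int where k: "x = q powi k" by blast
  show "jtheta x q = 0"
  proof (cases "k \<le> 0")
    case True
    then have "q ^ nat (- k) * x = 1"
      using k assms by (simp add: power_int_def field_simps)
    then show ?thesis using assms(1) by (auto simp: jtheta_eq_qfac qfac_eq_0_iff)
  next
    case False
    then have "nat k = Suc (nat (k - 1))" by simp
    then have "q ^ nat (k - 1) * (q / x) = 1"
      using k False assms by (simp add: power_int_def field_simps)
    then show ?thesis using assms(1) by (auto simp: jtheta_eq_qfac qfac_eq_0_iff)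
  qed
qed

lemma holomorphic_jtheta:
  assumes "norm q < 1" "f holomorphic_on A" "\<And>z. z \<in> A \<Longrightarrow> f z \<noteq> 0"
  shows "(\<lambda>z. jtheta (f z) q) holomorphic_on A"
proof -
  have *: "(\<lambda>z. qfac q (g z)) holomorphic_on A" if "g holomorphic_on A" for g
    using holomorphic_on_compose_gen[OF that holomorphic_qfac[OF assms(1)]] by (simp add: o_def)
  have "(\<lambda>z. qfac q (f z)) holomorphic_on A" "(\<lambda>z. qfac q (q / f z)) holomorphic_on A"
    by (rule *; use assms in \<open>auto intro!: holomorphic_intros\<close>)+
  then show ?thesis
    unfolding jtheta_eq_qfac[OF assms(1)] by (rule holomorphic_on_mult)
qed

lemma continuous_on_jtheta:
  assumes "norm q < 1" "continuous_on A f" "\<And>z. z \<in> A \<Longrightarrow> f z \<noteq> 0"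
  shows "continuous_on A (\<lambda>z. jtheta (f z) q)"
proof -
  have "(\<lambda>z. jtheta z q) holomorphic_on - {0}"
    by (rule holomorphic_jtheta) (use assms in \<open>auto intro!: holomorphic_intros\<close>)
  then show ?thesis
    by (rule continuous_on_compose2[OF holomorphic_on_imp_continuous_on]) (use assms in auto)
qed

text \<open>A point where the function is differentiable and nonzero also qualifies. Having only
  simple zeros thus becomes a pointwise condition that passes to products without common zeros and
  to local changes of variable.\<close>

definition simple_at :: "(complex \<Rightarrow> complex) \<Rightarrow> complex \<Rightarrow> bool" where
  "simple_at f z \<longleftrightarrow> (\<exists>D. (f has_field_derivative D) (at z) \<and> (f z = 0 \<longrightarrow> D \<noteq> 0))"

lemma simple_at_mult:
  assumes "simple_at f z" "simple_at g z" "f z \<noteq> 0 \<or> g z \<noteq> 0"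
  shows "simple_at (\<lambda>z. f z * g z) z"
proof -
  obtain D E where D: "(f has_field_derivative D) (at z)" "f z = 0 \<longrightarrow> D \<noteq> 0"
    and E: "(g has_field_derivative E) (at z)" "g z = 0 \<longrightarrow> E \<noteq> 0"
    using assms by (auto simp: simple_at_def)
  have "((\<lambda>z. f z * g z) has_field_derivative D * g z + f z * E) (at z)"
    using DERIV_mult[OF D(1) E(1)] by (simp add: algebra_simps)
  moreover have "f z * g z = 0 \<longrightarrow> D * g z + f z * E \<noteq> 0"
    using D(2) E(2) assms(3) by auto
  ultimately show ?thesis unfolding simple_at_def by blast
qed

lemma simple_at_nonzero:
  assumes "f field_differentiable at z" "f z \<noteq> 0"
  shows "simple_at f z"
  using assms by (auto simp: simple_at_def field_differentiable_def)

lemma simple_at_compose: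
  assumes "simple_at f (g z)" "(g has_field_derivative D) (at z)" "D \<noteq> 0"
  shows "simple_at (\<lambda>z. f (g z)) z"
proof -
  obtain E where E: "(f has_field_derivative E) (at (g z))" "f (g z) = 0 \<longrightarrow> E \<noteq> 0"
    using assms by (auto simp: simple_at_def)
  from DERIV_chain2[OF E(1) assms(2)] E(2) assms(3) show ?thesis
    unfolding simple_at_def by (intro exI[of _ "E * D"]) auto
qed

text \<open>The zeros are the integer powers of \<open>q\<close>. At 1 the factor
  \<open>1 - z\<close> gives simplicity, and the functional equation carries it to the other
  powers.\<close>

lemma simple_at_jtheta:
  assumes q: "norm q < 1" "q \<noteq> 0" and "x \<noteq> 0"
  shows "simple_at (\<lambda>z. jtheta z q) x"
proof -
  have hol: "(\<lambda>z. jtheta z q) holomorphic_on - {0}"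
    by (rule holomorphic_jtheta) (use q in \<open>auto intro!: holomorphic_intros\<close>)
  then have diff: "(\<lambda>z. jtheta z q) field_differentiable at z" if "z \<noteq> 0" for z
    using that by (auto simp: holomorphic_on_open field_differentiable_def open_Compl)
  \<comment> \<open>Differentiating the functional equation at a zero leaves only the term with the
    derivative of \<open>jtheta\<close>; the other product-rule term contains its value.\<close>
  have shift: "deriv (\<lambda>z. jtheta z q) z \<noteq> 0 \<longleftrightarrow> deriv (\<lambda>z. jtheta z q) (q * z) \<noteq> 0"
    if z: "z \<noteq> 0" "jtheta z q = 0" for z
  proof -
    let ?D = "deriv (\<lambda>z. jtheta z q)"
    have 1: "((\<lambda>z. jtheta z q) has_field_derivative ?D z) (at z)"
      "((\<lambda>z. jtheta z q) has_field_derivative ?D (q * z)) (at (q * z))"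
      using diff z q by (auto simp: DERIV_deriv_iff_field_differentiable)
    have "((\<lambda>z. jtheta (q * z) q) has_field_derivative ?D (q * z) * q) (at z)"
      by (rule DERIV_chain2[where g = "\<lambda>z. q * z", OF 1(2)]) (auto intro!: derivative_eq_intros)
    moreover have "((\<lambda>z. - inverse z * jtheta z q) has_field_derivative - inverse z * ?D z) (at z)"
      using DERIV_mult[OF DERIV_minus[OF DERIV_inverse[OF z(1)]] 1(1)] z by (simp add: mult.commute)
    then have "((\<lambda>z. jtheta (q * z) q) has_field_derivative - inverse z * ?D z) (at z)"
      by (rule has_field_derivative_transform_within_open[of _ _ _ "- {0}"])
         (use z q in \<open>auto simp: jtheta_mult_nome\<close>)
    ultimately have "?D (q * z) * q = - inverse z * ?D z"
      by (rule DERIV_unique)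
    then show ?thesis using q z by auto
  qed
  have base: "deriv (\<lambda>z. jtheta z q) 1 \<noteq> 0"
  proof -
    \<comment> \<open>\<open>jtheta\<close> with its factor \<open>1 - z\<close> removed; it is
      nonzero at 1 because no positive power of \<open>q\<close> equals 1.\<close>
    define P where "P = (\<lambda>z. qfac q (q * z) * qfac q (q / z))"
    have factor: "jtheta z q = (1 - z) * P z" for z
      unfolding jtheta_eq_qfac[OF q(1)] P_def by (subst qfac_rec[OF q(1)]) simp
    have "(\<lambda>z. qfac q (q * z)) holomorphic_on - {0}" "(\<lambda>z. qfac q (q / z)) holomorphic_on - {0}"
      using holomorphic_on_compose_gen[OF _ holomorphic_qfac[OF q(1)], of "\<lambda>z. q * z" "- {0}"]
        holomorphic_on_compose_gen[OF _ holomorphic_qfac[OF q(1)], of "\<lambda>z. q / z" "- {0}"]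
        holomorphic_on_divide[OF holomorphic_on_const holomorphic_on_ident, of "- {0}" q]
      by (auto simp: o_def intro!: holomorphic_intros)
    then have "P holomorphic_on - {0}"
      unfolding P_def by (rule holomorphic_on_mult)
    then have "\<exists>D. (P has_field_derivative D) (at 1)"
      by (simp add: holomorphic_on_open open_Compl)
    then obtain D where "(P has_field_derivative D) (at 1)" ..
    then have "((\<lambda>z. (1 - z) * P z) has_field_derivative - P 1) (at 1)"
      by (auto intro!: derivative_eq_intros)
    then have "((\<lambda>z. jtheta z q) has_field_derivative - P 1) (at 1)"
      by (rule has_field_derivative_transform_within_open[of _ _ _ "- {0}"])
         (auto simp: factor open_Compl)
    moreover have "q ^ j * q \<noteq> 1" for j
    proof -
      have "norm (q ^ Suc j) < 1"
        unfolding norm_power using q by (intro power_Suc_less_one) auto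
      then have "q ^ Suc j \<noteq> 1" by auto
      then show ?thesis by (simp add: mult.commute)
    qed
    then have "P 1 \<noteq> 0" using q by (auto simp: P_def qfac_eq_0_iff)
    ultimately show ?thesis by (auto dest: DERIV_imp_deriv)
  qed
  have "deriv (\<lambda>z. jtheta z q) (q powi k) \<noteq> 0" for k :: int
  proof (induction k rule: int_induct[where k = 0])
    case base
    then show ?case using \<open>deriv _ 1 \<noteq> 0\<close> by simp
  next
    case (step1 i)
    have "jtheta (q powi i) q = 0" using q by (subst jtheta_eq_0_iff) auto
    moreover have "q * q powi i = q powi (i + 1)"
      using q by (simp add: power_int_add)
    ultimately show ?case using shift[of "q powi i"] step1 q by auto
  next
    case (step2 i)
    have "jtheta (q powi (i - 1)) q = 0" using q by (subst jtheta_eq_0_iff) auto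
    moreover have "q * q powi (i - 1) = q powi i"
      using q by (simp add: power_int_diff)
    ultimately show ?case using shift[of "q powi (i - 1)"] step2 q by auto
  qed
  then have "jtheta x q = 0 \<longrightarrow> deriv (\<lambda>z. jtheta z q) x \<noteq> 0"
    using jtheta_eq_0_iff[OF assms] by blast
  moreover have "((\<lambda>z. jtheta z q) has_field_derivative deriv (\<lambda>z. jtheta z q) x) (at x)"
    using diff[OF assms(3)] by (simp add: DERIV_deriv_iff_field_differentiable)
  ultimately show ?thesis
    unfolding simple_at_def by blast
qed

section \<open>Holomorphic functions on the punctured plane\<close>

text \<open>The punctured plane is connected, so a function that is nonzero somewhere has isolated
  zeros.\<close>

lemma holomorphic_punctured_nonzero_near:
  fixes f :: "complex \<Rightarrow> complex"
  assumes f: "f holomorphic_on - {0}" and a: "a \<noteq> 0" "f a \<noteq> 0" and x: "x \<noteq> 0"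
    and U: "open U" "x \<in> U"
  obtains z where "z \<in> U" "z \<noteq> 0" "f z \<noteq> 0"
proof (cases "f x = 0")
  case False
  then show ?thesis using that x U by blast
next
  case True
  have conn: "connected (- {0 :: complex})"
    by (rule connected_punctured_universe) simp
  obtain r where r: "0 < r" "ball x r \<subseteq> - {0}" "\<And>z. z \<in> ball x r - {x} \<Longrightarrow> f z \<noteq> 0"
    using isolated_zeros[OF f _ conn, of x a] True a x by (auto simp: open_Compl)
  obtain e where e: "e > 0" "ball x e \<subseteq> U"
    using U openE by blast
  have "x islimpt ball x (min r e)"
    using r e by (intro interior_limit_point) auto
  then obtain z where "z \<in> ball x (min r e)" "z \<noteq> x"
    by (metis islimptE centre_in_ball e(1) min_less_iff_conj open_ball r(1))
  then show ?thesis using that r e by (metis ComplD DiffI insertI1 mem_ball min_less_iff_conj singletonD subsetD)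
qed

text \<open>A cancellation rule: functional equations may be divided by \<open>g\<close> although
  \<open>g\<close> has zeros.\<close>

lemma holomorphic_punctured_eq_0:
  fixes A g :: "complex \<Rightarrow> complex"
  assumes A: "A holomorphic_on - {0}" and g: "g holomorphic_on - {0}" "a \<noteq> 0" "g a \<noteq> 0"
    and prod: "\<And>x. x \<noteq> 0 \<Longrightarrow> A x * g x = 0" and x: "x \<noteq> 0"
  shows "A x = 0"
proof (rule ccontr)
  assume nz: "A x \<noteq> 0"
  have "continuous_on (- {0}) A" by (rule holomorphic_on_imp_continuous_on[OF A])
  then have "open (- {0} \<inter> A -` (- {0}))"
    by (rule continuous_open_preimage) (auto simp: open_Compl)
  then obtain z where "z \<in> - {0} \<inter> A -` (- {0})" "g z \<noteq> 0"
    using holomorphic_punctured_nonzero_near[OF g x] nz x by auto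
  then show False using prod[of z] by auto
qed

text \<open>Every zero of \<open>g\<close> is simple and shared by \<open>f\<close>, so the quotient
  has only removable singularities.\<close>

lemma holomorphic_quotient:
  fixes f g :: "complex \<Rightarrow> complex"
  assumes f: "f holomorphic_on - {0}" and g: "g holomorphic_on - {0}"
    and simple: "\<And>z. z \<noteq> 0 \<Longrightarrow> simple_at g z"
    and zeros: "\<And>z. z \<noteq> 0 \<Longrightarrow> g z = 0 \<Longrightarrow> f z = 0"
  obtains h where "h holomorphic_on - {0}" "h 0 = 0" "\<And>z. z \<noteq> 0 \<Longrightarrow> f z = h z * g z"
proof -
  \<comment> \<open>At a common zero the value is that of l'Hopital's rule; the value at the origin
    follows the normalisation of \<open>theta_space\<close>.\<close>
  define h where "h z = (if z = 0 then 0 else if g z = 0 then deriv f z / deriv g z else f z / g z)" for z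
  have op: "open (- {0 :: complex})" by (simp add: open_Compl)
  have "\<exists>D. (h has_field_derivative D) (at a)" if a: "a \<noteq> 0" for a
  proof (cases "g a = 0")
    case True
    \<comment> \<open>Difference quotients completed by the derivative at \<open>a\<close> are
      holomorphic. As \<open>f\<close> and \<open>g\<close> both vanish at \<open>a\<close>, the
      ratio of their difference quotients is \<open>h\<close> near \<open>a\<close>.\<close>
    let ?q = "\<lambda>k z. if z = a then deriv k a else (k z - k a) / (z - a)"
    have qf: "?q f holomorphic_on - {0}" and qg: "?q g holomorphic_on - {0}"
      by (rule pole_lemma_open[OF f op], rule pole_lemma_open[OF g op])
    have ga: "deriv g a \<noteq> 0"
      using simple[OF a] True by (auto simp: simple_at_def dest: DERIV_imp_deriv)
    have "continuous_on (- {0}) (?q g)"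
      by (rule holomorphic_on_imp_continuous_on[OF qg])
    then have opU: "open (- {0} \<inter> ?q g -` (- {0}))" (is "open ?U")
      by (rule continuous_open_preimage) (auto simp: open_Compl)
    have aU: "a \<in> ?U" using a ga by simp
    have "(\<lambda>z. ?q f z / ?q g z) holomorphic_on ?U"
      by (rule holomorphic_on_divide[OF holomorphic_on_subset[OF qf] holomorphic_on_subset[OF qg]]) auto
    then have "\<exists>D. ((\<lambda>z. ?q f z / ?q g z) has_field_derivative D) (at a)"
      using opU aU by (metis (no_types, lifting) holomorphic_on_open)
    then obtain D where "((\<lambda>z. ?q f z / ?q g z) has_field_derivative D) (at a)" ..
    then have "(h has_field_derivative D) (at a)"
    proof (rule has_field_derivative_transform_within_open[OF _ opU aU])
      fix z assume "z \<in> ?U"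
      then show "?q f z / ?q g z = h z"
        using True zeros[OF a True] a by (auto simp: h_def split: if_splits)
    qed
    then show ?thesis ..
  next
    case False
    have "continuous_on (- {0}) g" by (rule holomorphic_on_imp_continuous_on[OF g])
    then have opU: "open (- {0} \<inter> g -` (- {0}))" (is "open ?U")
      by (rule continuous_open_preimage) (auto simp: open_Compl)
    have aU: "a \<in> ?U" using a False by simp
    have "(\<lambda>z. f z / g z) holomorphic_on ?U"
      by (rule holomorphic_on_divide[OF holomorphic_on_subset[OF f] holomorphic_on_subset[OF g]]) auto
    then have "\<exists>D. ((\<lambda>z. f z / g z) has_field_derivative D) (at a)"
      using opU aU by (metis (no_types, lifting) holomorphic_on_open)
    then obtain D where "((\<lambda>z. f z / g z) has_field_derivative D) (at a)" ..
    then have "(h has_field_derivative D) (at a)"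
      by (rule has_field_derivative_transform_within_open[OF _ opU aU]) (auto simp: h_def)
    then show ?thesis ..
  qed
  then have "h holomorphic_on - {0}" by (simp add: holomorphic_on_open op)
  moreover have "f z = h z * g z" if "z \<noteq> 0" for z
    using simple[OF that] zeros[OF that] that by (auto simp: h_def)
  ultimately show ?thesis using that[of h] by (simp add: h_def)
qed

text \<open>Composing with the exponential function reduces this to Liouville's theorem.\<close>

lemma multiplicatively_periodic_const:
  fixes f :: "complex \<Rightarrow> complex"
  assumes f: "f holomorphic_on - {0}" and q: "q \<noteq> 0" "norm q < 1"
    and per: "\<And>x. x \<noteq> 0 \<Longrightarrow> f (q * x) = f x"
  obtains c where "\<And>x. x \<noteq> 0 \<Longrightarrow> f x = c"
proof -
  \<comment> \<open>A closed annulus that meets every orbit of multiplication by \<open>q\<close>;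
    on it \<open>f\<close> already takes all its values.\<close>
  define K where "K = {z :: complex. norm q \<le> norm z \<and> norm z \<le> 1}"
  have perk: "f (q powi k * x) = f x" if "x \<noteq> 0" for k :: int and x
  proof (induction k rule: int_induct[where k = 0])
    case (step1 i)
    then show ?case using per[of "q powi i * x"] that q
      by (simp add: power_int_add mult_ac)
  next
    case (step2 i)
    then show ?case using per[of "q powi (i - 1) * x"] that q
      by (simp add: power_int_diff mult_ac)
  qed simp
  have "compact K"
  proof -
    have "K = cball 0 1 - ball 0 (norm q)" by (auto simp: K_def)
    then show ?thesis by (simp add: compact_diff)
  qed
  moreover have "continuous_on K f"
    by (rule continuous_on_subset[OF holomorphic_on_imp_continuous_on[OF f]]) (use q in \<open>auto simp: K_def\<close>)
  ultimately have "bounded (f ` K)"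
    by (intro compact_imp_bounded compact_continuous_image)
  moreover have "f x \<in> f ` K" if "x \<noteq> 0" for x
  proof -
    \<comment> \<open>The logarithm of \<open>norm x\<close> to base \<open>norm q\<close>. Its
      integer part counts the factors \<open>q\<close> to strip off until the point lies in
      \<open>K\<close>; inequalities reverse because \<open>ln (norm q)\<close> is negative.\<close>
    define r where "r = ln (norm x) / ln (norm q)"
    define k where "k = \<lfloor>r\<rfloor>"
    have lq: "ln (norm q) < 0" using q by simp
    have "of_int k \<le> r" "r < of_int k + 1" by (auto simp: k_def floor_le_iff)
    then have "ln (norm q) * of_int k \<ge> ln (norm x)" "ln (norm x) > ln (norm q) * (of_int k + 1)"
      using lq by (auto simp: r_def field_simps)
    moreover have "ln (norm q powi j) = of_int j * ln (norm q)" for j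
      using q by (simp add: powr_real_of_int'[symmetric] ln_powr)
    ultimately have "ln (norm q powi k) \<ge> ln (norm x)" "ln (norm x) > ln (norm q powi (k + 1))"
      by (auto simp: mult.commute)
    then have le: "norm x \<le> norm q powi k" "norm q powi (k + 1) < norm x"
      using q that by (auto simp: ln_le_cancel_iff)
    have "norm q \<le> norm x / norm q powi k" "norm x / norm q powi k \<le> 1"
      using le q by (auto simp: field_simps power_int_add)
    moreover have "norm (q powi (- k) * x) = norm x / norm q powi k"
      by (simp add: norm_mult norm_divide norm_power_int power_int_minus field_simps)
    ultimately have "q powi (- k) * x \<in> K"
      by (simp only: K_def mem_Collect_eq)
    then show ?thesis using perk[OF that, of "- k"] by (metis imageI)
  qed
  ultimately have "bounded (range (\<lambda>z. f (exp z)))"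
    by (elim bounded_subset) auto
  moreover have "(\<lambda>z. f (exp z)) holomorphic_on UNIV"
  proof -
    have "exp ` UNIV \<subseteq> - {0 :: complex}" by (rule image_subsetI) simp
    from holomorphic_on_compose_gen[OF holomorphic_on_exp f this] show ?thesis by (simp add: o_def)
  qed
  ultimately have "(\<lambda>z. f (exp z)) constant_on UNIV" by (intro Liouville_theorem)
  then obtain c where "\<And>z. f (exp z) = c" by (auto simp: constant_on_def)
  then have "f x = c" if "x \<noteq> 0" for x using that exp_Ln by metis
  then show ?thesis by (rule that)
qed

text \<open>A function vanishing on the whole punctured plane would have derivative 0 at 1. The
  point obtained feeds the cancellation rule.\<close>

lemma simple_at_nontrivial:
  assumes "\<And>z. z \<noteq> 0 \<Longrightarrow> simple_at g z"
  obtains a where "a \<noteq> 0" "g a \<noteq> 0"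
proof -
  have False if zero: "\<And>a. a \<noteq> 0 \<Longrightarrow> g a = 0"
  proof -
    obtain D where D: "(g has_field_derivative D) (at 1)" "D \<noteq> 0"
      using assms[of 1] zero[of 1] by (auto simp: simple_at_def)
    have "((\<lambda>_. 0) has_field_derivative 0) (at (1 :: complex))" by simp
    then have "(g has_field_derivative 0) (at 1)"
      by (rule has_field_derivative_transform_within_open[of _ _ _ "- {0}"]) (auto simp: zero open_Compl)
    with D show False by (blast dest: DERIV_unique)
  qed
  then show ?thesis using that by blast
qed

lemma powi_neg: "x powi (- numeral k) = inverse (x ^ numeral k :: complex)"
  by (simp add: power_int_minus)

section \<open>The spaces of theta functions\<close>

definition cbrt1 :: complex where
  "cbrt1 = exp (2 * pi * \<i> / 3)"

lemma cbrt1_cube: "cbrt1 ^ 3 = 1"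
proof -
  have "cbrt1 ^ 3 = exp (of_nat 3 * (2 * pi * \<i> / 3))"
    unfolding cbrt1_def by (rule exp_of_nat_mult[symmetric])
  also have "of_nat 3 * (2 * pi * \<i> / 3) = 2 * of_real pi * \<i>" by simp
  finally show ?thesis by (simp add: exp_eq_1)
qed

lemma cbrt1_nonzero [simp]: "cbrt1 \<noteq> 0"
  by (simp add: cbrt1_def)

lemma cbrt1_quadratic: "cbrt1 ^ 2 + cbrt1 + 1 = 0"
proof -
  have "cbrt1 \<noteq> 1"
  proof
    assume "cbrt1 = 1"
    then obtain n :: int where "2 * pi / 3 = of_int (2 * n) * pi"
      by (auto simp: cbrt1_def exp_eq_1)
    then have "of_int (3 * n) = (1 :: real)" by simp
    then have "3 * n = 1" by linarith
    then show False by presburger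
  qed
  moreover have "(cbrt1 - 1) * (cbrt1 ^ 2 + cbrt1 + 1) = 0"
    using cbrt1_cube by (simp add: algebra_simps power2_eq_square power3_eq_cube)
  ultimately show ?thesis by simp
qed

lemma cube_eq_cube:
  fixes a b :: complex
  assumes "a ^ 3 = b ^ 3"
  shows "a = b \<or> a = cbrt1 * b \<or> a = cbrt1 ^ 2 * b"
proof -
  have sq: "cbrt1 ^ 2 = - cbrt1 - 1"
    using cbrt1_quadratic by (simp add: algebra_simps eq_neg_iff_add_eq_0)
  have "(a - b) * (a - cbrt1 * b) * (a - cbrt1 ^ 2 * b) =
     a ^ 3 - (1 + cbrt1 + cbrt1 ^ 2) * a ^ 2 * b + (cbrt1 + cbrt1 ^ 2 + cbrt1 ^ 3) * a * b ^ 2 - cbrt1 ^ 3 * b ^ 3"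
    by (simp add: algebra_simps power2_eq_square power3_eq_cube)
  also have "\<dots> = 0" using assms by (simp add: sq cbrt1_cube)
  finally show ?thesis by simp
qed

section \<open>Transformation rules and simple zeros of the two theta factors\<close>

locale nome =
  fixes p :: complex
  assumes p: "p \<noteq> 0" "norm p < 1"
begin

abbreviation tu where "tu \<equiv> tu_factor p"
abbreviation w where "w \<equiv> v_factor p"
abbreviation V where "V \<equiv> theta_space p"

lemma norm_nome_power: "k > 0 \<Longrightarrow> norm (p ^ k) < 1"
  using p by (simp add: norm_power power_less_one_iff)

lemma nome6: "norm (p ^ 6) < 1" "p ^ 6 \<noteq> 0" and nome2: "norm (p ^ 2) < 1" "p ^ 2 \<noteq> 0"
  using p by (auto intro: norm_nome_power)

lemma holomorphic_tu:
  assumes "f holomorphic_on A" "g holomorphic_on A" "\<And>z. z \<in> A \<Longrightarrow> f z \<noteq> 0" "\<And>z. z \<in> A \<Longrightarrow> g z \<noteq> 0"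
  shows "(\<lambda>z. tu (f z) (g z)) holomorphic_on A"
  unfolding tu_factor_def using assms
  by (intro holomorphic_on_mult holomorphic_jtheta nome6 holomorphic_intros) auto

lemma continuous_on_tu:
  assumes "continuous_on A f" "continuous_on A g" "\<And>z. z \<in> A \<Longrightarrow> f z \<noteq> 0" "\<And>z. z \<in> A \<Longrightarrow> g z \<noteq> 0"
  shows "continuous_on A (\<lambda>z. tu (f z) (g z))"
  unfolding tu_factor_def using assms
  by (intro continuous_on_mult continuous_on_jtheta nome6 continuous_intros) auto

lemma holomorphic_w:
  assumes "f holomorphic_on A" "\<And>z. z \<in> A \<Longrightarrow> f z \<noteq> 0"
  shows "(\<lambda>z. w (f z)) holomorphic_on A"
  unfolding v_factor_def using assms p
  by (intro holomorphic_on_mult holomorphic_jtheta nome2 holomorphic_intros) auto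

lemma continuous_on_w:
  assumes "continuous_on A f" "\<And>z. z \<in> A \<Longrightarrow> f z \<noteq> 0"
  shows "continuous_on A (\<lambda>z. w (f z))"
  unfolding v_factor_def using assms p
  by (intro continuous_on_mult continuous_on_jtheta nome2 continuous_intros) auto

lemma tu_cbrt1: "tu (cbrt1 * t) u = tu t u"
proof -
  have "(cbrt1 * t) ^ 3 = t ^ 3" by (simp add: power_mult_distrib cbrt1_cube)
  then show ?thesis by (simp add: tu_factor_def powi_neg)
qed

text \<open>The prefactor \<open>u powi (- 3)\<close> is what turns the inversion rule of
  \<open>jtheta\<close> into antisymmetry.\<close>

lemma tu_antisym:
  assumes "t \<noteq> 0" "u \<noteq> 0"
  shows "tu u t = - tu t u"
proof -
  have "jtheta (t ^ 3 * u powi (- 3)) (p ^ 6) = jtheta (inverse (u ^ 3 * t powi (- 3))) (p ^ 6)"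
    using assms by (simp add: powi_neg mult.commute)
  also have "\<dots> = - inverse (u ^ 3 * t powi (- 3)) * jtheta (u ^ 3 * t powi (- 3)) (p ^ 6)"
    using assms by (intro jtheta_inverse nome6) auto
  finally have 1: "jtheta (t ^ 3 * u powi (- 3)) (p ^ 6) =
    - inverse (u ^ 3 * t powi (- 3)) * jtheta (u ^ 3 * t powi (- 3)) (p ^ 6)" .
  have 2: "t powi (- 3) * inverse (u ^ 3 * t powi (- 3)) = u powi (- 3)"
    using assms by (simp add: powi_neg)
  have "tu u t = - (t powi (- 3) * inverse (u ^ 3 * t powi (- 3))) *
      (jtheta (u ^ 3 * t ^ 3) (p ^ 6) * jtheta (u ^ 3 * t powi (- 3)) (p ^ 6))"
    unfolding tu_factor_def 1 by (simp only: mult_ac mult_minus_left mult_minus_right)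
  then show ?thesis
    unfolding 2 by (simp add: tu_factor_def)
qed

lemma tu_inverse: "tu (inverse t) u = tu t u"
  by (simp add: tu_factor_def powi_neg power_inverse mult.commute)

text \<open>The cube of the argument changes by the full nome \<open>p ^ 6\<close>, so one theta
  factor is shifted up and the other down; the dependence on \<open>u\<close> cancels between
  them.\<close>

lemma tu_nome:
  assumes "t \<noteq> 0" "u \<noteq> 0"
  shows "tu (p ^ 2 * t) u = p powi (- 6) * t powi (- 6) * tu t u"
proof -
  have "jtheta (u ^ 3 * (p ^ 2 * t) ^ 3) (p ^ 6) = jtheta (p ^ 6 * (u ^ 3 * t ^ 3)) (p ^ 6)"
    by (simp add: power_mult_distrib mult_ac flip: power_mult)
  also have "\<dots> = - inverse (u ^ 3 * t ^ 3) * jtheta (u ^ 3 * t ^ 3) (p ^ 6)"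
    using assms by (intro jtheta_mult_nome nome6) auto
  finally have 1: "jtheta (u ^ 3 * (p ^ 2 * t) ^ 3) (p ^ 6) = - inverse (u ^ 3 * t ^ 3) * jtheta (u ^ 3 * t ^ 3) (p ^ 6)" .
  have "jtheta (u ^ 3 * (p ^ 2 * t) powi (- 3)) (p ^ 6) = jtheta ((u ^ 3 * t powi (- 3)) / p ^ 6) (p ^ 6)"
    using assms p by (simp add: powi_neg power_mult_distrib field_simps flip: power_mult)
  also have "\<dots> = - ((u ^ 3 * t powi (- 3)) / p ^ 6) * jtheta (u ^ 3 * t powi (- 3)) (p ^ 6)"
    using assms by (intro jtheta_div_nome nome6) auto
  finally have 2: "jtheta (u ^ 3 * (p ^ 2 * t) powi (- 3)) (p ^ 6) =
    - ((u ^ 3 * t powi (- 3)) / p ^ 6) * jtheta (u ^ 3 * t powi (- 3)) (p ^ 6)" .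
  have 3: "inverse (u ^ 3 * t ^ 3) * ((u ^ 3 * t powi (- 3)) / p ^ 6) = p powi (- 6) * t powi (- 6)"
    using assms p by (simp add: powi_neg field_simps flip: power_add)
  show ?thesis
    unfolding tu_factor_def 1 2 3[symmetric] by (simp add: mult_ac)
qed

lemma tu_diag:
  assumes "t \<noteq> 0"
  shows "tu t t = 0"
proof -
  have "jtheta (t ^ 3 * t powi (- 3)) (p ^ 6) = 0"
    using assms by (subst jtheta_eq_0_iff[OF nome6]) (auto simp: powi_neg intro!: exI[of _ 0])
  then show ?thesis by (simp add: tu_factor_def)
qed

text \<open>Each theta factor has simple zeros. The product of the two arguments is
  \<open>s ^ 6\<close>, so a common zero would make \<open>s ^ 6\<close> a power of
  \<open>p ^ 6\<close>, which the last hypothesis excludes.\<close>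

lemma simple_at_tu:
  assumes "z \<noteq> 0" "s \<noteq> 0" "jtheta (s ^ 6) (p ^ 6) \<noteq> 0"
  shows "simple_at (\<lambda>z. tu z s) z"
proof -
  have a: "simple_at (\<lambda>z. jtheta (s ^ 3 * z ^ 3) (p ^ 6)) z"
    by (rule simple_at_compose[OF simple_at_jtheta[OF nome6], of "\<lambda>z. s ^ 3 * z ^ 3" z "s ^ 3 * (3 * z ^ 2)"])
       (use assms in \<open>auto intro!: derivative_eq_intros\<close>)
  have "((\<lambda>z. s ^ 3 * z powi (- 3)) has_field_derivative s ^ 3 * (of_int (- 3) * z powi (- 3 - 1) * 1)) (at z)"
    using assms by (intro derivative_eq_intros refl) auto
  then have b: "simple_at (\<lambda>z. jtheta (s ^ 3 * z powi (- 3)) (p ^ 6)) z"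
    by (rule simple_at_compose[OF simple_at_jtheta[OF nome6], rotated]) (use assms in auto)
  have "jtheta (s ^ 3 * z ^ 3) (p ^ 6) \<noteq> 0 \<or> jtheta (s ^ 3 * z powi (- 3)) (p ^ 6) \<noteq> 0"
  proof (rule ccontr)
    assume "\<not> ?thesis"
    then have "jtheta (s ^ 3 * z ^ 3) (p ^ 6) = 0" "jtheta (s ^ 3 * z powi (- 3)) (p ^ 6) = 0" by auto
    then obtain k l where "s ^ 3 * z ^ 3 = (p ^ 6) powi k" "s ^ 3 * z powi (- 3) = (p ^ 6) powi l"
      using assms by (subst (asm) (1 2) jtheta_eq_0_iff[OF nome6]) auto
    then have "(s ^ 3 * z ^ 3) * (s ^ 3 * z powi (- 3)) = (p ^ 6) powi (k + l)"
      using nome6 by (simp add: power_int_add)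
    also have "(s ^ 3 * z ^ 3) * (s ^ 3 * z powi (- 3)) = s ^ 3 * s ^ 3"
      using assms by (simp add: powi_neg field_simps)
    also have "\<dots> = s ^ 6" by (simp flip: power_add)
    finally show False
      using assms jtheta_eq_0_iff[OF nome6, of "s ^ 6"] by (metis power_not_zero)
  qed
  then have c: "simple_at (\<lambda>z. jtheta (s ^ 3 * z ^ 3) (p ^ 6) * jtheta (s ^ 3 * z powi (- 3)) (p ^ 6)) z"
    by (rule simple_at_mult[OF a b])
  have d: "simple_at (\<lambda>z. s powi (- 3)) z"
    by (rule simple_at_nonzero) (use assms in auto)
  show ?thesis
    unfolding tu_factor_def by (rule simple_at_mult[OF d c]) (use assms in auto)
qed

lemma w_nome:
  assumes "x \<noteq> 0"
  shows "w (p ^ 2 * x) = p powi (- 2) * x powi (- 3) * w x"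
proof -
  have 1: "jtheta (p * (p ^ 2 * x)) (p ^ 2) = - inverse (p * x) * jtheta (p * x) (p ^ 2)"
    using jtheta_mult_nome[OF nome2, of "p * x"] assms p by (simp add: mult_ac)
  have 2: "jtheta (- p * (p ^ 2 * x)) (p ^ 2) = - inverse (- p * x) * jtheta (- p * x) (p ^ 2)"
    using jtheta_mult_nome[OF nome2, of "- p * x"] assms p by (simp add: mult_ac)
  have "inverse x * inverse (p * x) * inverse (p * x) = p powi (- 2) * x powi (- 3)"
    using assms p by (simp add: powi_neg field_simps power2_eq_square power3_eq_cube)
  then show ?thesis
    unfolding v_factor_def 1 2 jtheta_mult_nome[OF nome2 assms]
    by (simp flip: \<open>_ = p powi (- 2) * x powi (- 3)\<close>)
qed

text \<open>The conclusions have the form in which \<open>theta_space_0_shift\<close> transports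
  zeros from 1, \<open>p\<close> and \<open>- p\<close>.\<close>

lemma w_zeros:
  assumes "x \<noteq> 0"
  shows "jtheta x (p ^ 2) = 0 \<Longrightarrow> \<exists>k::int. x = (p ^ 2) powi k * 1"
    "jtheta (p * x) (p ^ 2) = 0 \<Longrightarrow> \<exists>k::int. x = (p ^ 2) powi k * p"
    "jtheta (- p * x) (p ^ 2) = 0 \<Longrightarrow> \<exists>k::int. x = (p ^ 2) powi k * (- p)"
proof -
  assume "jtheta x (p ^ 2) = 0"
  then show "\<exists>k::int. x = (p ^ 2) powi k * 1"
    using assms p jtheta_eq_0_iff[OF nome2, of x] by auto
next
  assume "jtheta (p * x) (p ^ 2) = 0"
  then obtain k :: int where "p * x = (p ^ 2) powi k"
    using assms p jtheta_eq_0_iff[OF nome2, of "p * x"] by auto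
  then have "x = (p ^ 2) powi (k - 1) * p"
    using p by (simp add: power_int_diff field_simps power2_eq_square)
  then show "\<exists>k::int. x = (p ^ 2) powi k * p" ..
next
  assume "jtheta (- p * x) (p ^ 2) = 0"
  then obtain k :: int where "- p * x = (p ^ 2) powi k"
    using assms p jtheta_eq_0_iff[OF nome2, of "- p * x"] by auto
  then have "x = (p ^ 2) powi (k - 1) * (- p)"
    using p by (simp add: power_int_diff field_simps power2_eq_square minus_equation_iff[of "p * x"])
  then show "\<exists>k::int. x = (p ^ 2) powi k * (- p)" ..
qed

lemma nome_power_inj:
  assumes "norm p powi a = norm p powi b"
  shows "a = b"
proof (rule ccontr)
  assume "a \<noteq> b"
  then consider "a < b" | "b < a" by linarith
  then show False
    using power_int_strict_decreasing[of a b "norm p"] power_int_strict_decreasing[of b a "norm p"] p assms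
    by cases auto
qed

text \<open>The three factors have no common zeros. Absolute values are even powers of
  \<open>norm p\<close> on the orbit of 1 and odd powers on those of \<open>p\<close> and
  \<open>- p\<close>; the last two are separated by sign, since equal absolute values force equal
  exponents.\<close>

lemma simple_at_w:
  assumes x: "x \<noteq> 0"
  shows "simple_at w x"
proof -
  have nrm: "norm ((p ^ 2) powi k) = norm p powi (2 * k)" for k
    by (simp add: norm_power_int norm_power power_int_mult)
  have nrm': "norm ((p ^ 2) powi k * p) = norm p powi (2 * k + 1)" for k
    using p by (simp add: norm_mult nrm power_int_add)
  have A: "\<not> (jtheta x (p ^ 2) = 0 \<and> jtheta (p * x) (p ^ 2) = 0)"
  proof
    assume "jtheta x (p ^ 2) = 0 \<and> jtheta (p * x) (p ^ 2) = 0"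
    then obtain k l where "x = (p ^ 2) powi k" "x = (p ^ 2) powi l * p"
      using w_zeros[OF x] by (metis mult_1_right)
    then have "norm p powi (2 * k) = norm p powi (2 * l + 1)" by (metis nrm nrm')
    then have "2 * k = 2 * l + 1" by (rule nome_power_inj)
    then show False by presburger
  qed
  have B: "\<not> (jtheta x (p ^ 2) = 0 \<and> jtheta (- p * x) (p ^ 2) = 0)"
  proof
    assume "jtheta x (p ^ 2) = 0 \<and> jtheta (- p * x) (p ^ 2) = 0"
    then obtain k l where "x = (p ^ 2) powi k" "x = (p ^ 2) powi l * (- p)"
      using w_zeros[OF x] by (metis mult_1_right)
    then have "norm p powi (2 * k) = norm p powi (2 * l + 1)"
      by (metis nrm nrm' mult_minus_right norm_minus_cancel)
    then have "2 * k = 2 * l + 1" by (rule nome_power_inj)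
    then show False by presburger
  qed
  have C: "\<not> (jtheta (p * x) (p ^ 2) = 0 \<and> jtheta (- p * x) (p ^ 2) = 0)"
  proof
    assume "jtheta (p * x) (p ^ 2) = 0 \<and> jtheta (- p * x) (p ^ 2) = 0"
    then obtain k l where *: "x = (p ^ 2) powi k * p" "x = (p ^ 2) powi l * (- p)"
      using w_zeros[OF x] by (metis mult_1_right)
    then have "norm p powi (2 * k + 1) = norm p powi (2 * l + 1)"
      by (metis nrm' mult_minus_right norm_minus_cancel)
    then have "2 * k + 1 = 2 * l + 1" by (rule nome_power_inj)
    then show False using * x by auto
  qed
  have s1: "simple_at (\<lambda>x. jtheta x (p ^ 2)) x"
    by (rule simple_at_jtheta[OF nome2 x])
  have s2: "simple_at (\<lambda>x. jtheta (p * x) (p ^ 2)) x"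
    by (rule simple_at_compose[OF simple_at_jtheta[OF nome2], of "\<lambda>x. p * x" x p])
       (use p x in \<open>auto intro!: derivative_eq_intros\<close>)
  have s3: "simple_at (\<lambda>x. jtheta (- p * x) (p ^ 2)) x"
    by (rule simple_at_compose[OF simple_at_jtheta[OF nome2], of "\<lambda>x. - p * x" x "- p"])
       (use p x in \<open>auto intro!: derivative_eq_intros\<close>)
  have "simple_at (\<lambda>v. jtheta v (p ^ 2) * jtheta (p * v) (p ^ 2) * jtheta (- p * v) (p ^ 2)) x"
    by (intro simple_at_mult s1 s2 s3) (use A B C in auto)
  then show ?thesis unfolding v_factor_def[abs_def] .
qed

end

lemma holomorphic_on_compose_punctured:
  fixes f k :: "complex \<Rightarrow> complex"
  assumes "f holomorphic_on - {0}" "k holomorphic_on A" "\<And>x. x \<in> A \<Longrightarrow> k x \<noteq> 0"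
  shows "(\<lambda>x. f (k x)) holomorphic_on A"
proof -
  have "k ` A \<subseteq> - {0}" using assms(3) by (intro image_subsetI) simp
  from holomorphic_on_compose_gen[OF assms(2,1) this] show ?thesis by (simp add: o_def)
qed

section \<open>Zeros, multiplication and division in the spaces \<open>V n\<close>\<close>

context nome begin

definition multiplier :: "nat \<Rightarrow> complex \<Rightarrow> complex" where
  "multiplier n x = p powi (- 2 * (3 * int n + 1)) * x powi (- (6 * int n + 3))"

lemma multiplier_Suc:
  assumes "x \<noteq> 0"
  shows "multiplier (Suc n) x = multiplier n x * (p powi (- 6) * x powi (- 6))"
proof -
  have "p powi (- 2 * (3 * int (Suc n) + 1)) = p powi (- 2 * (3 * int n + 1)) * p powi (- 6)"
    using p by (subst power_int_add[symmetric]) auto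
  moreover have "x powi (- (6 * int (Suc n) + 3)) = x powi (- (6 * int n + 3)) * x powi (- 6)"
    using assms by (subst power_int_add[symmetric]) auto
  ultimately show ?thesis
    unfolding multiplier_def by (simp only: mult_ac)
qed

lemma multiplier_0: "multiplier 0 x = p powi (- 2) * x powi (- 3)"
  by (simp add: multiplier_def)

lemma multiplier_nonzero: "x \<noteq> 0 \<Longrightarrow> multiplier n x \<noteq> 0"
  using p by (simp add: multiplier_def)

lemma theta_space_iff:
  "f \<in> V n \<longleftrightarrow> f holomorphic_on - {0} \<and> f 0 = 0 \<and>
     (\<forall>x. x \<noteq> 0 \<longrightarrow> f (p ^ 2 * x) = multiplier n x * f x \<and> f (inverse x) = - inverse x * f x \<and>
        f x + cbrt1 * f (cbrt1 * x) + cbrt1 ^ 2 * f (cbrt1 ^ 2 * x) = 0)"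
proof -
  have "(\<Sum>k\<le>2. g k) = g 0 + g 1 + g 2" for g :: "nat \<Rightarrow> complex"
    by (simp add: eval_nat_numeral)
  then show ?thesis
    unfolding theta_space_def multiplier_def cbrt1_def[symmetric] by simp
qed

lemma theta_space_holomorphic: "f \<in> V n \<Longrightarrow> f holomorphic_on - {0}"
  by (simp add: theta_space_iff)

text \<open>As a function of \<open>z\<close>, \<open>tu\<close> depends on \<open>z ^ 3\<close>
  only, is invariant under inversion and contributes exactly the factor of
  \<open>multiplier_Suc\<close>, so every condition is inherited.\<close>

lemma theta_space_mult_tu:
  assumes "f \<in> V n" "u \<noteq> 0"
  shows "(\<lambda>z. f z * tu z u) \<in> V (Suc n)"
  unfolding theta_space_iff
proof (intro conjI allI impI)
  show "(\<lambda>z. f z * tu z u) holomorphic_on - {0}"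
    using assms by (intro holomorphic_on_mult holomorphic_tu holomorphic_intros)
      (auto simp: theta_space_holomorphic)
  show "f 0 * tu 0 u = 0" using assms by (simp add: theta_space_iff)
next
  fix x :: complex assume x: "x \<noteq> 0"
  have 1: "f (p ^ 2 * x) = multiplier n x * f x" "f (inverse x) = - inverse x * f x"
    and 2: "f x + cbrt1 * f (cbrt1 * x) + cbrt1 ^ 2 * f (cbrt1 ^ 2 * x) = 0"
    using assms x by (auto simp: theta_space_iff)
  show "f (p ^ 2 * x) * tu (p ^ 2 * x) u = multiplier (Suc n) x * (f x * tu x u)"
    by (simp add: 1 tu_nome x assms multiplier_Suc)
  show "f (inverse x) * tu (inverse x) u = - inverse x * (f x * tu x u)"
    by (simp add: 1 tu_inverse)
  have "tu (cbrt1 ^ 2 * x) u = tu x u"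
    using tu_cbrt1[of "cbrt1 * x" u] tu_cbrt1[of x u] by (simp add: power2_eq_square mult.assoc)
  then have "f x * tu x u + cbrt1 * (f (cbrt1 * x) * tu (cbrt1 * x) u) +
      cbrt1 ^ 2 * (f (cbrt1 ^ 2 * x) * tu (cbrt1 ^ 2 * x) u) =
    (f x + cbrt1 * f (cbrt1 * x) + cbrt1 ^ 2 * f (cbrt1 ^ 2 * x)) * tu x u"
    by (simp add: tu_cbrt1 algebra_simps)
  then show "f x * tu x u + cbrt1 * (f (cbrt1 * x) * tu (cbrt1 * x) u) +
      cbrt1 ^ 2 * (f (cbrt1 ^ 2 * x) * tu (cbrt1 ^ 2 * x) u) = 0"
    by (simp add: 2)
qed

lemma theta_space_0_shift:
  assumes "f \<in> V n" "x \<noteq> 0" "f x = 0"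
  shows "f ((p ^ 2) powi k * x) = 0"
proof (induction k rule: int_induct[where k = 0])
  case (step1 i)
  have "(p ^ 2) powi (i + 1) * x = p ^ 2 * ((p ^ 2) powi i * x)"
    using nome2 by (simp add: power_int_add)
  moreover have "f (p ^ 2 * ((p ^ 2) powi i * x)) = multiplier n ((p ^ 2) powi i * x) * f ((p ^ 2) powi i * x)"
    using assms(1,2) p by (auto simp: theta_space_iff)
  ultimately show ?case by (simp only: step1 mult_zero_right)
next
  case (step2 i)
  have "(p ^ 2) powi i * x = p ^ 2 * ((p ^ 2) powi (i - 1) * x)"
    using nome2 by (simp add: power_int_diff)
  moreover have "f (p ^ 2 * ((p ^ 2) powi (i - 1) * x)) = multiplier n ((p ^ 2) powi (i - 1) * x) * f ((p ^ 2) powi (i - 1) * x)"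
    using assms(1,2) p by (auto simp: theta_space_iff)
  ultimately have "multiplier n ((p ^ 2) powi (i - 1) * x) * f ((p ^ 2) powi (i - 1) * x) = 0"
    by (metis step2.IH)
  then show ?case using multiplier_nonzero[of "(p ^ 2) powi (i - 1) * x" n] assms(2) p by simp
qed (use assms in simp)

text \<open>By the trace condition two zeros in an orbit of \<open>cbrt1\<close> force the third.
  Inversion and shifts by \<open>p ^ 2\<close> then carry the full orbit of \<open>s\<close> to all
  zeros of \<open>tu\<close>.\<close>

lemma theta_space_0_at_tu_zeros:
  assumes f: "f \<in> V n" and s: "s \<noteq> 0" "f s = 0" "f (cbrt1 * s) = 0" and z: "z \<noteq> 0" "tu z s = 0"
  shows "f z = 0"
proof -
  define P where "P x \<longleftrightarrow> x \<noteq> 0 \<and> f x = 0 \<and> f (cbrt1 * x) = 0 \<and> f (cbrt1 ^ 2 * x) = 0" for x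
  have tr: "f x + cbrt1 * f (cbrt1 * x) + cbrt1 ^ 2 * f (cbrt1 ^ 2 * x) = 0"
    and inv: "f (inverse x) = - inverse x * f x" if "x \<noteq> 0" for x
    using f that by (auto simp: theta_space_iff)
  have Ps: "P s" using tr[OF s(1)] s by (simp add: P_def)
  have Pinv: "P (inverse x)" if "P x" for x
  proof -
    have "cbrt1 * inverse x = inverse (cbrt1 ^ 2 * x)" "cbrt1 ^ 2 * inverse x = inverse (cbrt1 * x)"
      using cbrt1_cube that by (auto simp: P_def field_simps power2_eq_square power3_eq_cube)
    then show ?thesis
      using that inv[of x] inv[of "cbrt1 * x"] inv[of "cbrt1 ^ 2 * x"] by (simp add: P_def)
  qed
  have Pshift: "P ((p ^ 2) powi k * x)" if "P x" for x k
    using theta_space_0_shift[OF f, of x k] theta_space_0_shift[OF f, of "cbrt1 * x" k]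
      theta_space_0_shift[OF f, of "cbrt1 ^ 2 * x" k] that p by (simp add: P_def mult_ac)
  have Pz: "f z = 0" if "P x" "z ^ 3 = x ^ 3" for x
    using cube_eq_cube[OF that(2)] that(1) by (auto simp: P_def)
  \<comment> \<open>Cubing turns the shifts by \<open>p ^ 2\<close> into the shifts by
    \<open>p ^ 6\<close> that describe the zeros of \<open>tu\<close>.\<close>
  have pw: "((p ^ 2) powi k) ^ 3 = (p ^ 6) powi k" for k
    by (simp add: power_int_power power_int_power' flip: power_mult power_int_mult)
  consider "jtheta (s ^ 3 * z ^ 3) (p ^ 6) = 0" | "jtheta (s ^ 3 * z powi (- 3)) (p ^ 6) = 0"
    using z s by (auto simp: tu_factor_def)
  then show ?thesis
  proof cases
    case 1
    then obtain k where "s ^ 3 * z ^ 3 = (p ^ 6) powi k"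
      using s z by (subst (asm) jtheta_eq_0_iff[OF nome6]) auto
    then have "z ^ 3 = ((p ^ 2) powi k * inverse s) ^ 3"
      using s by (simp add: power_mult_distrib pw field_simps)
    with Pz Pshift Pinv Ps show ?thesis by blast
  next
    case 2
    then obtain k where "s ^ 3 * z powi (- 3) = (p ^ 6) powi k"
      using s z by (subst (asm) jtheta_eq_0_iff[OF nome6]) auto
    then have "s ^ 3 = (p ^ 6) powi k * z ^ 3"
      using z by (simp add: powi_neg field_simps)
    then have "z ^ 3 = ((p ^ 2) powi (- k) * s) ^ 3"
      using p by (simp add: power_mult_distrib pw power_int_minus field_simps)
    with Pz Pshift Ps show ?thesis by blast
  qed
qed

lemma jtheta_sixth_power_nontrivial:
  obtains s where "s \<noteq> 0" "jtheta (s ^ 6) (p ^ 6) \<noteq> 0"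
proof -
  obtain z where z: "z \<noteq> 0" "jtheta z (p ^ 6) \<noteq> 0"
    using simple_at_nontrivial simple_at_jtheta[OF nome6] by blast
  obtain s where "s ^ 6 = z"
    by (metis exists_complex_root zero_neq_numeral)
  then show ?thesis using z that[of s] by auto
qed

lemma w_nontrivial:
  obtains b where "b \<noteq> 0" "w b \<noteq> 0"
  using simple_at_nontrivial simple_at_w by blast

text \<open>The converse of \<open>theta_space_mult_tu\<close>: the two prescribed zeros make every
  zero of \<open>tu\<close> a zero of \<open>f\<close>, and these are simple by the condition on
  \<open>s ^ 6\<close>.\<close>

lemma theta_space_divide:
  assumes f: "f \<in> V (Suc n)" and s: "s \<noteq> 0" "f s = 0" "f (cbrt1 * s) = 0" and gen: "jtheta (s ^ 6) (p ^ 6) \<noteq> 0"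
  obtains h where "h \<in> V n" "\<And>z. z \<noteq> 0 \<Longrightarrow> f z = h z * tu z s"
proof -
  have g: "(\<lambda>z. tu z s) holomorphic_on - {0}"
    by (rule holomorphic_tu) (use s in \<open>auto intro!: holomorphic_intros\<close>)
  obtain h where h: "h holomorphic_on - {0}" "h 0 = 0" "\<And>z. z \<noteq> 0 \<Longrightarrow> f z = h z * tu z s"
    using holomorphic_quotient[OF theta_space_holomorphic[OF f] g simple_at_tu[OF _ s(1) gen]
      theta_space_0_at_tu_zeros[OF f s]] by blast
  obtain t0 where t0: "t0 \<noteq> 0" "tu t0 s \<noteq> 0"
    using simple_at_nontrivial simple_at_tu[OF _ s(1) gen] by blast
  have hol: "(\<lambda>x. h (p ^ 2 * x)) holomorphic_on - {0}" "(\<lambda>x. h (inverse x)) holomorphic_on - {0}"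
    "(\<lambda>x. h (cbrt1 * x)) holomorphic_on - {0}" "(\<lambda>x. h (cbrt1 ^ 2 * x)) holomorphic_on - {0}"
    by (rule holomorphic_on_compose_punctured[OF h(1)]; use p in \<open>auto intro!: holomorphic_intros\<close>)+
  have multiplier: "multiplier n holomorphic_on - {0}"
    unfolding multiplier_def[abs_def] by (auto intro!: holomorphic_intros)
  \<comment> \<open>Each condition on \<open>h\<close> is checked after multiplication by
    \<open>tu y s\<close>; this rule then removes the factor.\<close>
  note cancel = holomorphic_punctured_eq_0[OF _ g t0]
  have "h (p ^ 2 * x) - multiplier n x * h x = 0" if x: "x \<noteq> 0" for x
  proof (rule cancel[OF _ _ x])
    show "(\<lambda>x. h (p ^ 2 * x) - multiplier n x * h x) holomorphic_on - {0}"
      by (intro holomorphic_on_diff holomorphic_on_mult hol multiplier h(1))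
    fix y :: complex assume y: "y \<noteq> 0"
    have "f (p ^ 2 * y) = multiplier (Suc n) y * f y" using f y by (simp add: theta_space_iff)
    then have "h (p ^ 2 * y) * (p powi (- 6) * y powi (- 6) * tu y s) = multiplier (Suc n) y * (h y * tu y s)"
      using h(3)[of "p ^ 2 * y"] h(3)[of y] y p tu_nome[OF y s(1)] by simp
    then have "(p powi (- 6) * y powi (- 6)) * ((h (p ^ 2 * y) - multiplier n y * h y) * tu y s) = 0"
      by (simp add: multiplier_Suc[OF y] algebra_simps)
    then show "(h (p ^ 2 * y) - multiplier n y * h y) * tu y s = 0" using y p by simp
  qed
  moreover have "h (inverse x) + inverse x * h x = 0" if x: "x \<noteq> 0" for x
  proof (rule cancel[OF _ _ x])
    show "(\<lambda>x. h (inverse x) + inverse x * h x) holomorphic_on - {0}"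
      by (intro holomorphic_on_add holomorphic_on_mult holomorphic_on_inverse holomorphic_on_ident hol h(1)) auto
    fix y :: complex assume y: "y \<noteq> 0"
    have "f (inverse y) = - inverse y * f y" using f y by (simp add: theta_space_iff)
    then show "(h (inverse y) + inverse y * h y) * tu y s = 0"
      using h(3)[of "inverse y"] h(3)[of y] y by (simp add: tu_inverse algebra_simps)
  qed
  moreover have "h x + cbrt1 * h (cbrt1 * x) + cbrt1 ^ 2 * h (cbrt1 ^ 2 * x) = 0" if x: "x \<noteq> 0" for x
  proof (rule cancel[OF _ _ x])
    show "(\<lambda>x. h x + cbrt1 * h (cbrt1 * x) + cbrt1 ^ 2 * h (cbrt1 ^ 2 * x)) holomorphic_on - {0}"
      by (intro holomorphic_on_add holomorphic_on_mult holomorphic_on_const hol h(1))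
    fix y :: complex assume y: "y \<noteq> 0"
    have "f y + cbrt1 * f (cbrt1 * y) + cbrt1 ^ 2 * f (cbrt1 ^ 2 * y) = 0" using f y by (simp add: theta_space_iff)
    moreover have "tu (cbrt1 ^ 2 * y) s = tu y s"
      using tu_cbrt1[of "cbrt1 * y" s] tu_cbrt1[of y s] by (simp add: power2_eq_square mult.assoc)
    ultimately show "(h y + cbrt1 * h (cbrt1 * y) + cbrt1 ^ 2 * h (cbrt1 ^ 2 * y)) * tu y s = 0"
      using h(3)[of y] h(3)[of "cbrt1 * y"] h(3)[of "cbrt1 ^ 2 * y"] y
      by (simp add: tu_cbrt1 algebra_simps)
  qed
  ultimately have "h \<in> V n"
    using h by (auto simp: theta_space_iff eq_neg_iff_add_eq_0)
  then show ?thesis using h(3) that by blast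
qed

text \<open>One factor is divided out at a time. Since \<open>tu (s j) (s k)\<close> is nonzero for
  distinct nodes, the quotient still vanishes at the nodes that remain.\<close>

lemma theta_space_divide_prod:
  assumes "finite J"
  shows "f \<in> V (m + card J) \<Longrightarrow> (\<And>j. j \<in> J \<Longrightarrow> s j \<noteq> 0 \<and> f (s j) = 0 \<and> f (cbrt1 * s j) = 0 \<and> jtheta (s j ^ 6) (p ^ 6) \<noteq> 0)
    \<Longrightarrow> (\<And>j k. j \<in> J \<Longrightarrow> k \<in> J \<Longrightarrow> j \<noteq> k \<Longrightarrow> tu (s j) (s k) \<noteq> 0)
    \<Longrightarrow> \<exists>h \<in> V m. \<forall>z. z \<noteq> 0 \<longrightarrow> f z = h z * (\<Prod>j\<in>J. tu z (s j))"
  using assms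
proof (induction J arbitrary: f rule: finite_induct)
  case empty
  then show ?case by auto
next
  case (insert a J)
  have f: "f \<in> V (Suc (m + card J))" using insert by simp
  obtain g where g: "g \<in> V (m + card J)" "\<And>z. z \<noteq> 0 \<Longrightarrow> f z = g z * tu z (s a)"
    using theta_space_divide[OF f, of "s a"] insert.prems(2)[of a] by blast
  have "\<exists>h \<in> V m. \<forall>z. z \<noteq> 0 \<longrightarrow> g z = h z * (\<Prod>j\<in>J. tu z (s j))"
  proof (rule insert.IH[OF g(1)])
    fix j assume j: "j \<in> J"
    then have "tu (s j) (s a) \<noteq> 0"
      using insert.prems(3)[of j a] insert.hyps by auto
    then show "s j \<noteq> 0 \<and> g (s j) = 0 \<and> g (cbrt1 * s j) = 0 \<and> jtheta (s j ^ 6) (p ^ 6) \<noteq> 0"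
      using g(2)[of "s j"] g(2)[of "cbrt1 * s j"] insert.prems(2)[of j] j by (simp add: tu_cbrt1)
  qed (use insert.prems(3) in auto)
  then obtain h where "h \<in> V m" "\<forall>z. z \<noteq> 0 \<longrightarrow> g z = h z * (\<Prod>j\<in>J. tu z (s j))" by blast
  then show ?case using g(2) insert.hyps by (intro bexI[of _ h]) (auto simp: mult_ac)
qed

text \<open>The functional equations force zeros at 1, \<open>p\<close> and \<open>- p\<close>,
  hence at all zeros of \<open>w\<close>. The quotient by \<open>w\<close> is holomorphic and
  invariant under multiplication by \<open>p ^ 2\<close>, so it is constant.\<close>

lemma theta_space_0_eq:
  assumes h: "h \<in> V 0"
  obtains c where "\<And>z. z \<noteq> 0 \<Longrightarrow> h z = c * w z"
proof -
  have nome: "h (p ^ 2 * x) = p powi (- 2) * x powi (- 3) * h x" and inv: "h (inverse x) = - inverse x * h x"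
    if "x \<noteq> 0" for x using h that by (auto simp: theta_space_iff multiplier_0)
  have z: "h 1 = 0" using inv[of 1] by simp
  \<comment> \<open>The shift at \<open>inverse p\<close> combined with inversion gives
    \<open>h p = - h p\<close>; the point \<open>- p\<close> is treated alike.\<close>
  have "h p = p * h (inverse p)"
    using nome[of "inverse p"] p by (simp add: powi_neg field_simps power2_eq_square power3_eq_cube)
  then have zp: "h p = 0" using inv[of p] p by (simp flip: mult.assoc)
  have "h (- p) = - p * h (- inverse p)"
    using nome[of "- inverse p"] p by (simp add: powi_neg field_simps power2_eq_square power3_eq_cube)
  then have zm: "h (- p) = 0" using inv[of "- p"] p by (simp flip: mult.assoc)
  have wz: "h x = 0" if "x \<noteq> 0" "w x = 0" for x
    using that w_zeros[OF that(1)] theta_space_0_shift[OF h _ z] theta_space_0_shift[OF h _ zp]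
      theta_space_0_shift[OF h _ zm] p by (auto simp: v_factor_def)
  have wh: "w holomorphic_on - {0}"
    by (rule holomorphic_w) (auto intro!: holomorphic_intros)
  obtain c where c: "c holomorphic_on - {0}" "\<And>z. z \<noteq> 0 \<Longrightarrow> h z = c z * w z"
    using holomorphic_quotient[OF theta_space_holomorphic[OF h] wh simple_at_w wz] by blast
  obtain b where b: "b \<noteq> 0" "w b \<noteq> 0"
    by (rule w_nontrivial)
  have "c (p ^ 2 * x) - c x = 0" if x: "x \<noteq> 0" for x
  proof (rule holomorphic_punctured_eq_0[OF _ wh b _ x])
    have "(\<lambda>x. c (p ^ 2 * x)) holomorphic_on - {0}"
      by (rule holomorphic_on_compose_punctured[OF c(1)]) (use p in \<open>auto intro!: holomorphic_intros\<close>)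
    then show "(\<lambda>x. c (p ^ 2 * x) - c x) holomorphic_on - {0}"
      by (intro holomorphic_on_diff c(1))
    fix y :: complex assume y: "y \<noteq> 0"
    have "(p powi (- 2) * y powi (- 3)) * ((c (p ^ 2 * y) - c y) * w y) = 0"
      using nome[OF y] c(2)[OF y] c(2)[of "p ^ 2 * y"] w_nome[OF y] y p by (auto simp: algebra_simps)
    then show "(c (p ^ 2 * y) - c y) * w y = 0" using y p by simp
  qed
  then obtain d where "\<And>x. x \<noteq> 0 \<Longrightarrow> c x = d"
    using multiplicatively_periodic_const[OF c(1) nome2(2,1)] by auto
  then show ?thesis using c(2) by (intro that[of d]) simp
qed

end

section \<open>Determinants and bases of function spaces\<close>

lemma permutes_less_n: "\<pi> permutes {0..<n} \<Longrightarrow> i < n \<Longrightarrow> \<pi> i < (n :: nat)"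
  using permutes_in_image[of \<pi> "{0..<n}" i] by simp

text \<open>The Leibniz formula in terms of the entry function, which reduces continuity and
  holomorphy of a determinant to those of its entries.\<close>

lemma det_mat_eq:
  "det (mat n n (\<lambda>(i, j). a i j)) = (\<Sum>\<pi> | \<pi> permutes {0..<n}. signof \<pi> * (\<Prod>i = 0..<n. a i (\<pi> i)))"
  for a :: "nat \<Rightarrow> nat \<Rightarrow> 'a :: comm_ring_1"
proof -
  have "det (mat n n (\<lambda>(i, j). a i j)) =
      (\<Sum>\<pi> | \<pi> permutes {0..<n}. signof \<pi> * (\<Prod>i = 0..<n. mat n n (\<lambda>(i, j). a i j) $$ (i, \<pi> i)))"
    by (rule det_def') simp
  also have "\<dots> = (\<Sum>\<pi> | \<pi> permutes {0..<n}. signof \<pi> * (\<Prod>i = 0..<n. a i (\<pi> i)))"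
    by (intro sum.cong refl arg_cong2[of _ _ _ _ "(*)"] prod.cong)
       (auto dest: permutes_less_n)
  finally show ?thesis .
qed

lemma det_mat_cong:
  assumes "\<And>i j. i < n \<Longrightarrow> j < n \<Longrightarrow> a i j = b i j"
  shows "det (mat n n (\<lambda>(i, j). a i j)) = det (mat n n (\<lambda>(i, j). b i j))"
  using assms by (intro arg_cong[of _ _ det] eq_matI) auto

lemma det_mat_scale_rows:
  fixes a :: "nat \<Rightarrow> nat \<Rightarrow> 'a :: comm_ring_1"
  shows "det (mat n n (\<lambda>(i, j). r i * a i j)) = (\<Prod>i<n. r i) * det (mat n n (\<lambda>(i, j). a i j))"
  by (simp add: det_mat_eq prod.distrib sum_distrib_left lessThan_atLeast0 mult_ac)

lemma det_mat_transpose: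
  fixes a :: "nat \<Rightarrow> nat \<Rightarrow> 'a :: comm_ring_1"
  shows "det (mat n n (\<lambda>(i, j). a j i)) = det (mat n n (\<lambda>(i, j). a i j))"
proof -
  have "det (transpose_mat (mat n n (\<lambda>(i, j). a i j))) = det (mat n n (\<lambda>(i, j). a i j))"
    by (rule det_transpose[of _ n]) simp
  moreover have "transpose_mat (mat n n (\<lambda>(i, j). a i j)) = mat n n (\<lambda>(i, j). a j i)"
    by (intro eq_matI) auto
  ultimately show ?thesis by simp
qed

lemma det_mat_permute_rows:
  fixes a :: "nat \<Rightarrow> nat \<Rightarrow> 'a :: comm_ring_1"
  assumes "\<sigma> permutes {..<n}"
  shows "det (mat n n (\<lambda>(i, j). a (\<sigma> i) j)) = of_int (sign \<sigma>) * det (mat n n (\<lambda>(i, j). a i j))"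
proof -
  have \<sigma>: "\<sigma> permutes {0..<n}" using assms by (simp add: lessThan_atLeast0)
  have "det (mat n n (\<lambda>(i, j). mat n n (\<lambda>(i, j). a i j) $$ (\<sigma> i, j))) = signof \<sigma> * det (mat n n (\<lambda>(i, j). a i j))"
    by (rule det_permute_rows[OF _ \<sigma>]) simp
  also have "det (mat n n (\<lambda>(i, j). mat n n (\<lambda>(i, j). a i j) $$ (\<sigma> i, j))) = det (mat n n (\<lambda>(i, j). a (\<sigma> i) j))"
    by (rule det_mat_cong) (use permutes_less_n[OF \<sigma>] in auto)
  finally show ?thesis by simp
qed

lemma det_mat_zero_row:
  fixes a :: "nat \<Rightarrow> nat \<Rightarrow> 'a :: comm_ring_1"
  assumes "k < n" "\<And>j. j < n \<Longrightarrow> a k j = 0"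
  shows "det (mat n n (\<lambda>(i, j). a i j)) = 0"
proof -
  have "(\<Prod>i = 0..<n. a i (\<pi> i)) = 0" if "\<pi> permutes {0..<n}" for \<pi>
    by (rule prod_zero) (use assms permutes_less_n[OF that] in \<open>auto intro!: bexI[of _ k]\<close>)
  then show ?thesis by (simp add: det_mat_eq)
qed

lemma det_mat_equal_rows:
  fixes a :: "nat \<Rightarrow> nat \<Rightarrow> 'a :: comm_ring_1"
  assumes "k < n" "l < n" "k \<noteq> l" "\<And>j. j < n \<Longrightarrow> a k j = a l j"
  shows "det (mat n n (\<lambda>(i, j). a i j)) = 0"
  by (rule det_identical_rows[of _ n k l]) (use assms in \<open>auto intro!: eq_vecI\<close>)

text \<open>Laplace expansion with the cofactors fixed before the row \<open>r\<close> is chosen, so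
  that it expresses linearity in that row.\<close>

lemma det_mat_expand_row:
  fixes a :: "nat \<Rightarrow> nat \<Rightarrow> 'a :: comm_ring_1"
  assumes "k < n"
  obtains c where "\<And>r. det (mat n n (\<lambda>(i, j). if i = k then r j else a i j)) = (\<Sum>j<n. r j * c j)"
proof
  fix r
  define A where "A r = mat n n (\<lambda>(i, j). if i = k then r j else a i j)" for r :: "nat \<Rightarrow> 'a"
  have "det (A r) = (\<Sum>j<n. A r $$ (k, j) * cofactor (A r) k j)"
    by (rule laplace_expansion_row) (use assms in \<open>auto simp: A_def\<close>)
  \<comment> \<open>Cofactors along row \<open>k\<close> do not involve that row, so they may be
    computed with a zero row in its place.\<close>
  also have "\<dots> = (\<Sum>j<n. r j * cofactor (A (\<lambda>_. 0)) k j)"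
  proof (intro sum.cong refl arg_cong2[of _ _ _ _ "(*)"])
    fix j assume j: "j \<in> {..<n}"
    show "A r $$ (k, j) = r j" using assms j by (simp add: A_def)
    have "mat_delete (A r) k j = mat_delete (A (\<lambda>_. 0)) k j"
      by (rule eq_matI) (use j assms in \<open>auto simp: mat_delete_def A_def\<close>)
    then show "cofactor (A r) k j = cofactor (A (\<lambda>_. 0)) k j" by (simp add: cofactor_def)
  qed
  finally show "det (mat n n (\<lambda>(i, j). if i = k then r j else a i j)) =
      (\<Sum>j<n. r j * cofactor (A (\<lambda>_. 0)) k j)"
    by (simp add: A_def)
qed

text \<open>Only one cofactor survives in the Laplace expansion along the last row, whose index is
  \<open>n\<close>; the index map on columns skips \<open>l\<close>.\<close>

lemma det_mat_single_entry_row: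
  fixes a :: "nat \<Rightarrow> nat \<Rightarrow> 'a :: comm_ring_1"
  assumes "l \<le> n" "\<And>j. j \<le> n \<Longrightarrow> j \<noteq> l \<Longrightarrow> a n j = 0"
  shows "det (mat (Suc n) (Suc n) (\<lambda>(i, j). a i j)) =
    a n l * ((- 1) ^ (n + l) * det (mat n n (\<lambda>(i, j). a i (if j < l then j else Suc j))))"
proof -
  define A where "A = mat (Suc n) (Suc n) (\<lambda>(i, j). a i j)"
  have "det A = (\<Sum>j<Suc n. A $$ (n, j) * cofactor A n j)"
    by (rule laplace_expansion_row) (auto simp: A_def)
  also have "\<dots> = (\<Sum>j<Suc n. if j = l then a n l * cofactor A n l else 0)"
    by (intro sum.cong refl) (use assms in \<open>auto simp: A_def\<close>)
  also have "\<dots> = a n l * cofactor A n l"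
    using assms(1) by (simp add: less_Suc_eq_le)
  also have "mat_delete A n l = mat n n (\<lambda>(i, j). a i (if j < l then j else Suc j))"
    by (rule eq_matI) (use assms in \<open>auto simp: mat_delete_def A_def\<close>)
  then have "cofactor A n l = (- 1) ^ (n + l) * det (mat n n (\<lambda>(i, j). a i (if j < l then j else Suc j)))"
    by (simp add: cofactor_def)
  finally show ?thesis by (simp add: A_def)
qed

lemma holomorphic_on_det:
  fixes a :: "complex \<Rightarrow> nat \<Rightarrow> nat \<Rightarrow> complex"
  assumes "\<And>i j. i < n \<Longrightarrow> j < n \<Longrightarrow> (\<lambda>z. a z i j) holomorphic_on A"
  shows "(\<lambda>z. det (mat n n (\<lambda>(i, j). a z i j))) holomorphic_on A"
  unfolding det_mat_eq using assms
  by (intro holomorphic_on_sum holomorphic_on_mult holomorphic_on_prod holomorphic_on_const)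
     (auto dest: permutes_less_n)

lemma continuous_on_det:
  fixes a :: "'t :: topological_space \<Rightarrow> nat \<Rightarrow> nat \<Rightarrow> complex"
  assumes "\<And>i j. i < n \<Longrightarrow> j < n \<Longrightarrow> continuous_on A (\<lambda>z. a z i j)"
  shows "continuous_on A (\<lambda>z. det (mat n n (\<lambda>(i, j). a z i j)))"
  unfolding det_mat_eq using assms
  by (intro continuous_on_sum continuous_on_mult continuous_on_prod continuous_on_const)
     (auto dest: permutes_less_n)

text \<open>The coefficient vector lies in the kernel of a nonsingular matrix.\<close>

lemma sum_vanishing_at_nodes:
  fixes b :: "nat \<Rightarrow> complex \<Rightarrow> complex"
  assumes "det (mat m m (\<lambda>(i, j). b j (y i))) \<noteq> 0" "\<And>i. i < m \<Longrightarrow> (\<Sum>j<m. a j * b j (y i)) = 0" "j < m"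
  shows "a j = 0"
proof -
  let ?A = "mat m m (\<lambda>(i, j). b j (y i))"
  have "?A *\<^sub>v vec m a = 0\<^sub>v m"
    using assms(2) by (intro eq_vecI) (auto simp: scalar_prod_def lessThan_atLeast0 mult.commute)
  then have "vec m a = 0\<^sub>v m"
    using det_0_iff_vec_prod_zero[of ?A m] assms(1) vec_carrier[of m a] mat_carrier by blast
  then show ?thesis using assms(3) by (metis index_vec index_zero_vec(1))
qed

section \<open>Coordinates and interpolation nodes for a basis of functions\<close>

lemma basis_family_sum:
  assumes "basis_family W m b" "f \<in> W"
  obtains a where "\<And>z. f z = (\<Sum>j<m. a j * b j z)"
proof -
  have "f \<in> cfun.span (b ` {..<m})" using assms by (simp add: basis_family_def)
  then obtain c where c: "f = (\<Sum>v\<in>b ` {..<m}. fun_scale (c v) v)"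
    by (auto simp: cfun.span_finite)
  have "inj_on b {..<m}" using assms by (simp add: basis_family_def)
  then have "f = (\<Sum>j<m. fun_scale (c (b j)) (b j))"
    unfolding c by (simp add: sum.reindex)
  moreover have "(\<Sum>j\<in>A. fun_scale (c (b j)) (b j)) z = (\<Sum>j\<in>A. c (b j) * b j z)" if "finite A" for z A
    using that by (induction A rule: finite_induct) (auto simp: fun_scale_def)
  ultimately have "f z = (\<Sum>j<m. c (b j) * b j z)" for z
    by simp
  then show ?thesis by (rule that)
qed

lemma basis_family_sum_eq_0:
  assumes "basis_family W m b" "\<And>z. (\<Sum>j<m. a j * b j z) = 0" "j < m"
  shows "a j = 0"
proof -
  have inj: "inj_on b {..<m}" and ind: "cfun.independent (b ` {..<m})"
    using assms by (auto simp: basis_family_def)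
  have "(\<Sum>j\<in>A. fun_scale (a j) (b j)) z = (\<Sum>j\<in>A. a j * b j z)" if "finite A" for z A
    using that by (induction A rule: finite_induct) (auto simp: fun_scale_def)
  then have "(\<Sum>j<m. fun_scale (a j) (b j)) = 0"
    using assms(2) by (auto simp: fun_eq_iff)
  moreover have "(\<Sum>v\<in>b ` {..<m}. fun_scale (a (the_inv_into {..<m} b v)) v) = (\<Sum>j<m. fun_scale (a j) (b j))"
    using inj by (simp add: sum.reindex the_inv_into_f_f)
  ultimately have "a (the_inv_into {..<m} b (b j)) = 0"
    using cfun.independentD[OF ind, of "b ` {..<m}" "\<lambda>v. a (the_inv_into {..<m} b v)" "b j"] assms(3) by auto
  then show ?thesis using inj assms(3) by (simp add: the_inv_into_f_f)
qed

lemma basis_family_in: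
  assumes "basis_family W m b" "j < m"
  shows "b j \<in> W"
  using assms cfun.span_superset[of "b ` {..<m}"] by (auto simp: basis_family_def)

text \<open>Nodes are added one by one. The next minor, expanded along its last row, is a nontrivial
  combination of independent functions of the new node, so some node makes it nonzero.\<close>

lemma basis_family_nodes:
  assumes "basis_family W m b"
  obtains y where "det (mat m m (\<lambda>(i, j). b j (y i))) \<noteq> 0"
proof -
  have "k \<le> m \<Longrightarrow> \<exists>y. det (mat k k (\<lambda>(i, j). b j (y i))) \<noteq> 0" for k
  proof (induction k)
    case 0
    then show ?case by simp
  next
    case (Suc k)
    then obtain y where y: "det (mat k k (\<lambda>(i, j). b j (y i))) \<noteq> 0" by auto
    obtain c where c: "\<And>r. det (mat (Suc k) (Suc k) (\<lambda>(i, j). if i = k then r j else b j (y i))) = (\<Sum>j<Suc k. r j * c j)"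
      using det_mat_expand_row[of k "Suc k" "\<lambda>i j. b j (y i)"] by auto
    \<comment> \<open>Inserting a unit row identifies the coefficient of \<open>b k\<close> as the
      previous minor.\<close>
    have "c k = det (mat (Suc k) (Suc k) (\<lambda>(i, j). if i = k then (if j = k then 1 else 0) else b j (y i)))"
      using c[of "\<lambda>j. if j = k then 1 else 0"] by simp
    also have "\<dots> = det (mat k k (\<lambda>(i, j). b j (y i)))"
      by (subst det_mat_single_entry_row[where l = k]) (auto intro!: det_mat_cong)
    finally have ck: "c k \<noteq> 0" using y by simp
    have "\<exists>z. (\<Sum>j<Suc k. b j z * c j) \<noteq> 0"
    proof (rule ccontr)
      assume "\<not> ?thesis"
      then have "(\<Sum>j<Suc k. c j * b j z) = 0" for z by (simp add: mult.commute)
      \<comment> \<open>The coefficients are padded with zeros because independence concerns all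
        \<open>m\<close> functions together.\<close>
      moreover have "(\<Sum>j<m. (if j < Suc k then c j else 0) * b j z) = (\<Sum>j<Suc k. c j * b j z)" for z
        by (rule sum.mono_neutral_cong_right) (use Suc.prems in auto)
      ultimately have "(if k < Suc k then c k else 0) = 0"
        using Suc.prems by (intro basis_family_sum_eq_0[OF assms, of "\<lambda>j. if j < Suc k then c j else 0"]) auto
      then show False using ck by simp
    qed
    then obtain z where "(\<Sum>j<Suc k. b j z * c j) \<noteq> 0" ..
    then have "det (mat (Suc k) (Suc k) (\<lambda>(i, j). if i = k then b j z else b j (y i))) \<noteq> 0"
      using c[of "\<lambda>j. b j z"] by simp
    also have "(\<lambda>(i, j). if i = k then b j z else b j (y i)) = (\<lambda>(i, j). b j ((y(k := z)) i))"
      by (auto simp: fun_eq_iff)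
    finally show ?case by blast
  qed
  then show ?thesis using that by blast
qed

section \<open>Generic points\<close>

definition nonzero_points :: "nat \<Rightarrow> (nat \<Rightarrow> complex) set" where
  "nonzero_points m = {x. \<forall>i<m. x i \<noteq> 0}"

text \<open>
  Separate holomorphy suffices to make the zero set nowhere dense: the identity theorem is
  applied to one coordinate at a time.
\<close>

definition generic :: "nat \<Rightarrow> ((nat \<Rightarrow> complex) \<Rightarrow> complex) \<Rightarrow> bool" where
  "generic m Q \<longleftrightarrow> (\<forall>x y. (\<forall>i<m. x i = y i) \<longrightarrow> Q x = Q y) \<and>
     (\<forall>x\<in>nonzero_points m. \<forall>k<m. (\<lambda>z. Q (x(k := z))) holomorphic_on - {0}) \<and>
     (\<exists>x\<in>nonzero_points m. Q x \<noteq> 0)"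

lemma nonzero_points_upd: "x \<in> nonzero_points m \<Longrightarrow> z \<noteq> 0 \<Longrightarrow> x(k := z) \<in> nonzero_points m"
  by (auto simp: nonzero_points_def)

lemma open_nonzero_points: "open (nonzero_points m)"
proof -
  have "nonzero_points m = (\<Inter>i\<in>{..<m}. (\<lambda>x. x i) -` (- {0}))"
    by (auto simp: nonzero_points_def)
  moreover have "open ((\<lambda>x :: nat \<Rightarrow> complex. x i) -` (- {0}))" for i
    by (intro open_vimage) (auto simp: open_Compl)
  ultimately show ?thesis by (simp add: open_INT)
qed

text \<open>Points where \<open>A\<close> and \<open>B\<close> are nonzero are made to agree one
  coordinate at a time: by the identity theorem in that coordinate, some common value keeps both
  functions nonzero.\<close>

lemma generic_mult:
  assumes A: "generic m A" and B: "generic m B"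
  shows "generic m (\<lambda>x. A x * B x)"
proof -
  have depA: "A x = A y" if "\<forall>i<m. x i = y i" for x y using A that unfolding generic_def by blast
  have depB: "B x = B y" if "\<forall>i<m. x i = y i" for x y using B that unfolding generic_def by blast
  have holA: "(\<lambda>z. A (x(k := z))) holomorphic_on - {0}" if "x \<in> nonzero_points m" "k < m" for x k
    using A that unfolding generic_def by blast
  have holB: "(\<lambda>z. B (x(k := z))) holomorphic_on - {0}" if "x \<in> nonzero_points m" "k < m" for x k
    using B that unfolding generic_def by blast
  have step: "\<exists>c\<in>nonzero_points m. A c \<noteq> 0 \<and> B c \<noteq> 0"
    if "k \<le> m" "a \<in> nonzero_points m" "b \<in> nonzero_points m" "A a \<noteq> 0" "B b \<noteq> 0" "\<forall>i\<ge>k. a i = b i" for k a b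
    using that
  proof (induction k arbitrary: a b)
    case 0
    then have "a = b" by auto
    then show ?case using 0 by auto
  next
    case (Suc k)
    then have k: "k < m" by simp
    have nz: "a k \<noteq> 0" "b k \<noteq> 0" using Suc.prems k by (auto simp: nonzero_points_def)
    let ?A = "\<lambda>z. A (a(k := z))" and ?B = "\<lambda>z. B (b(k := z))"
    have hA: "?A holomorphic_on - {0}" "?A (a k) \<noteq> 0" and hB: "?B holomorphic_on - {0}" "?B (b k) \<noteq> 0"
      using holA holB Suc.prems k by auto
    have "\<exists>z. z \<noteq> 0 \<and> ?A z * ?B z \<noteq> 0"
      using holomorphic_punctured_eq_0[OF hA(1) hB(1) nz(2) hB(2) _ nz(1)] hA(2) by blast
    then obtain z where z: "z \<noteq> 0" "?A z \<noteq> 0" "?B z \<noteq> 0" by auto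
    have agree: "\<forall>i\<ge>k. (a(k := z)) i = (b(k := z)) i"
      using Suc.prems(6) by (auto simp: Suc_le_eq)
    show ?case
      by (rule Suc.IH[OF _ nonzero_points_upd[OF _ z(1)] nonzero_points_upd[OF _ z(1)] z(2,3) agree])
         (use Suc.prems in simp_all)
  qed
  obtain a b where ab: "a \<in> nonzero_points m" "b \<in> nonzero_points m" "A a \<noteq> 0" "B b \<noteq> 0"
    using A B by (auto simp: generic_def)
  \<comment> \<open>\<open>B\<close> does not see coordinates from \<open>m\<close> on, so they may
    be copied from \<open>a\<close>, as \<open>step\<close> with \<open>k = m\<close>
    requires.\<close>
  define b' where "b' i = (if i < m then b i else a i)" for i
  have "B b' = B b" by (rule depB) (simp add: b'_def)
  then have "\<exists>c\<in>nonzero_points m. A c \<noteq> 0 \<and> B c \<noteq> 0"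
    using ab by (intro step[of m a b']) (auto simp: b'_def nonzero_points_def)
  moreover have "(\<lambda>z. A (x(k := z)) * B (x(k := z))) holomorphic_on - {0}"
    if "x \<in> nonzero_points m" "k < m" for x k
    by (rule holomorphic_on_mult[OF holA[OF that] holB[OF that]])
  moreover have "A x * B x = A y * B y" if "\<forall>i<m. x i = y i" for x y
    using depA[OF that] depB[OF that] by simp
  ultimately show ?thesis unfolding generic_def by (intro conjI allI ballI impI) auto
qed

lemma generic_1: "generic m (\<lambda>_. 1)"
proof -
  have "(\<lambda>_. 1) \<in> nonzero_points m" by (auto simp: nonzero_points_def)
  then show ?thesis by (auto simp: generic_def)
qed

lemma generic_prod:
  "finite I \<Longrightarrow> (\<And>i. i \<in> I \<Longrightarrow> generic m (A i)) \<Longrightarrow> generic m (\<lambda>x. \<Prod>i\<in>I. A i x)"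
  by (induction I rule: finite_induct) (auto intro: generic_1 generic_mult)

lemma generic_power: "generic m A \<Longrightarrow> generic m (\<lambda>x. A x ^ k)"
  by (induction k) (auto intro: generic_1 generic_mult)

lemma generic_coordinate:
  assumes "F holomorphic_on - {0}" "b \<noteq> 0" "F b \<noteq> 0" "k < m"
  shows "generic m (\<lambda>x. F (x k))"
proof -
  have "(\<lambda>_. b) \<in> nonzero_points m" using assms by (auto simp: nonzero_points_def)
  moreover have "(\<lambda>z. F ((x(l := z)) k)) holomorphic_on - {0}" for x l
    using assms(1) by (cases "l = k") auto
  ultimately show ?thesis unfolding generic_def using assms by auto
qed

text \<open>A point with nonzero value and the given point receive the same new value in one
  coordinate after another. Choosing it close to the given coordinate keeps the second point in
  \<open>U\<close>, while \<open>Q\<close> stays nonzero at the first; finally the two points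
  coincide.\<close>

lemma generic_dense:
  assumes Q: "generic m Q" and x: "x \<in> nonzero_points m" and U: "open U" "x \<in> U"
  obtains y where "y \<in> U" "y \<in> nonzero_points m" "Q y \<noteq> 0"
proof -
  have dep: "Q x = Q y" if "\<forall>i<m. x i = y i" for x y using Q that unfolding generic_def by blast
  have step: "\<exists>y\<in>U. y \<in> nonzero_points m \<and> Q y \<noteq> 0"
    if "k \<le> m" "a \<in> nonzero_points m" "x \<in> nonzero_points m" "Q a \<noteq> 0" "\<forall>i\<ge>k. a i = x i" "x \<in> U" for k a x
    using that
  proof (induction k arbitrary: a x)
    case 0
    then have "a = x" by auto
    then show ?case using 0 by auto
  next
    case (Suc k)
    then have k: "k < m" by simp
    have hol: "(\<lambda>z. Q (a(k := z))) holomorphic_on - {0}"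
      using Q Suc.prems k by (auto simp: generic_def)
    have "continuous_on UNIV (\<lambda>z. (x(k := z)) i)" for i
      by (cases "i = k") (auto intro!: continuous_intros)
    then have "continuous_on UNIV (\<lambda>z. x(k := z))"
      by (intro continuous_on_coordinatewise_then_product)
    then have op: "open ((\<lambda>z. x(k := z)) -` U)"
      using U(1) by (intro open_vimage)
    obtain z where z: "x(k := z) \<in> U" "z \<noteq> 0" "Q (a(k := z)) \<noteq> 0"
      using holomorphic_punctured_nonzero_near[OF hol _ _ _ op, of "a k" "x k"] Suc.prems k
      by (auto simp: nonzero_points_def)
    have agree: "\<forall>i\<ge>k. (a(k := z)) i = (x(k := z)) i"
      using Suc.prems(5) by (auto simp: Suc_le_eq)
    show ?case
      by (rule Suc.IH[OF _ nonzero_points_upd[OF _ z(2)] nonzero_points_upd[OF _ z(2)] z(3) agree z(1)])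
         (use Suc.prems in simp_all)
  qed
  obtain a where a: "a \<in> nonzero_points m" "Q a \<noteq> 0"
    using Q by (auto simp: generic_def)
  define a' where "a' i = (if i < m then a i else x i)" for i
  have "Q a' = Q a" by (rule dep) (simp add: a'_def)
  then have "\<exists>y\<in>U. y \<in> nonzero_points m \<and> Q y \<noteq> 0"
    using a x U by (intro step[of m a' x]) (auto simp: a'_def nonzero_points_def)
  then show ?thesis using that by blast
qed

text \<open>Density extends identities proved under nonvanishing conditions to all points with
  nonzero coordinates.\<close>

lemma generic_imp_eq_0:
  fixes f :: "(nat \<Rightarrow> complex) \<Rightarrow> complex"
  assumes f: "continuous_on (nonzero_points m) f" and Q: "generic m Q"
    and 0: "\<And>x. x \<in> nonzero_points m \<Longrightarrow> Q x \<noteq> 0 \<Longrightarrow> f x = 0" and x: "x \<in> nonzero_points m"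
  shows "f x = 0"
proof (rule ccontr)
  assume "f x \<noteq> 0"
  have "open (nonzero_points m \<inter> f -` (- {0}))"
    by (rule continuous_open_preimage[OF f open_nonzero_points]) (simp add: open_Compl)
  then obtain y where "y \<in> nonzero_points m \<inter> f -` (- {0})" "Q y \<noteq> 0"
    using generic_dense[OF Q x] \<open>f x \<noteq> 0\<close> x by (metis (no_types, lifting) ComplI IntI singletonD vimageI)
  then show False using 0[of y] by auto
qed

text \<open>
  The coordinates of a point are replaced by nodes one at a time; at a point all of whose
  coordinates are nodes, antisymmetry reduces \<open>E\<close> to a multiple of \<open>E y\<close>.
\<close>

lemma alternating_eq_0:
  fixes E :: "(nat \<Rightarrow> complex) \<Rightarrow> complex" and b :: "nat \<Rightarrow> complex \<Rightarrow> complex"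
    and X :: "complex set" and m :: nat
  defines "P \<equiv> {x. \<forall>i<m. x i \<in> X}"
  assumes cong: "\<And>x x'. x \<in> P \<Longrightarrow> (\<And>i. i < m \<Longrightarrow> x i = x' i) \<Longrightarrow> E x = E x'"
    and anti: "\<And>x i j. x \<in> P \<Longrightarrow> i < m \<Longrightarrow> j < m \<Longrightarrow> i \<noteq> j \<Longrightarrow> E (x \<circ> Transposition.transpose i j) = - E x"
    and lin: "\<And>x k. x \<in> P \<Longrightarrow> k < m \<Longrightarrow> \<exists>a. \<forall>z\<in>X. E (x(k := z)) = (\<Sum>j<m. a j * b j z)"
    and y: "y \<in> P" "E y = 0" "det (mat m m (\<lambda>(i, j). b j (y i))) \<noteq> 0"
    and x: "x \<in> P"
  shows "E x = 0"
proof -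
  have trP: "x \<circ> Transposition.transpose i j \<in> P" if "x \<in> P" "i < m" "j < m" for x i j
    using that by (auto simp: P_def Transposition.transpose_def)
  have perm: "E (x \<circ> \<sigma>) = 0" if "\<sigma> permutes {..<m}" "x \<in> P" "E x = 0" for \<sigma> x
    using that(1) finite_lessThan[of m] that(2,3)
  proof (induction \<sigma> arbitrary: x rule: permutes_induct)
    case id
    then show ?case by simp
  next
    case (swap a c \<sigma>)
    have "E (x \<circ> Transposition.transpose a c) = 0"
      using anti[of x a c] swap by (cases "a = c") auto
    moreover have "x \<circ> Transposition.transpose a c \<in> P"
      using swap.hyps swap.prems by (intro trP) auto
    ultimately have "E ((x \<circ> Transposition.transpose a c) \<circ> \<sigma>) = 0"
      by (rule swap.IH[rotated])
    then show ?case by (simp add: o_def)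
  qed
  have nodes: "E x = 0" if x: "x \<in> P" and xy: "\<forall>i<m. x i \<in> y ` {..<m}" for x
  proof -
    obtain \<kappa> where \<kappa>: "\<And>i. i < m \<Longrightarrow> \<kappa> i < m \<and> x i = y (\<kappa> i)"
    proof -
      have "\<forall>i. \<exists>k. i < m \<longrightarrow> k < m \<and> x i = y k" using xy by blast
      from choice[OF this] show ?thesis using that by blast
    qed
    show ?thesis
    proof (cases "inj_on \<kappa> {..<m}")
      case True
      define \<sigma> where "\<sigma> i = (if i < m then \<kappa> i else i)" for i
      have inj: "inj_on \<sigma> {..<m}" using True by (auto simp: \<sigma>_def inj_on_def)
      moreover have "\<sigma> ` {..<m} \<subseteq> {..<m}" using \<kappa> by (auto simp: \<sigma>_def)
      ultimately have "bij_betw \<sigma> {..<m} {..<m}"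
        by (simp add: bij_betw_def endo_inj_surj)
      then have "\<sigma> permutes {..<m}"
        by (rule bij_imp_permutes) (simp add: \<sigma>_def)
      then have "E (y \<circ> \<sigma>) = 0" using perm y by blast
      moreover have "E x = E (y \<circ> \<sigma>)"
        by (rule cong[OF x]) (use \<kappa> in \<open>auto simp: \<sigma>_def\<close>)
      ultimately show ?thesis by simp
    next
      case False
      then obtain i j where ij: "i < m" "j < m" "i \<noteq> j" "\<kappa> i = \<kappa> j"
        by (auto simp: inj_on_def)
      \<comment> \<open>A repeated node makes \<open>x\<close> invariant under a transposition,
        whence \<open>E x = - E x\<close>.\<close>
      then have "x \<circ> Transposition.transpose i j = x"
        using \<kappa> by (auto simp: fun_eq_iff Transposition.transpose_def)
      with anti[OF x ij(1,2,3)] show ?thesis by simp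
    qed
  qed
  \<comment> \<open>Only the first \<open>k\<close> coordinates are arbitrary. When coordinate
    \<open>k\<close> is released, the induction hypothesis makes the corresponding combination of
    the \<open>b j\<close> vanish at all nodes, so its coefficients are zero.\<close>
  have "k \<le> m \<Longrightarrow> x \<in> P \<Longrightarrow> \<forall>i<m. k \<le> i \<longrightarrow> x i \<in> y ` {..<m} \<Longrightarrow> E x = 0" for k x
  proof (induction k arbitrary: x)
    case 0
    then show ?case using nodes by auto
  next
    case (Suc k)
    then have k: "k < m" by simp
    obtain a where a: "\<forall>z\<in>X. E (x(k := z)) = (\<Sum>j<m. a j * b j z)"
      using lin[OF Suc.prems(2) k] by blast
    have "(\<Sum>j<m. a j * b j (y i)) = 0" if i: "i < m" for i
    proof -
      have "y i \<in> X" using y(1) i by (simp add: P_def)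
      have nd: "\<forall>l<m. k \<le> l \<longrightarrow> (x(k := y i)) l \<in> y ` {..<m}"
      proof (intro allI impI)
        fix l assume "l < m" "k \<le> l"
        then show "(x(k := y i)) l \<in> y ` {..<m}"
          using Suc.prems(3) i by (cases "l = k") auto
      qed
      have "x(k := y i) \<in> P"
        using Suc.prems(2) \<open>y i \<in> X\<close> by (simp add: P_def)
      from Suc.IH[OF less_imp_le[OF k] this nd] have "E (x(k := y i)) = 0" .
      with \<open>y i \<in> X\<close> show ?thesis using a by simp
    qed
    then have "a j = 0" if "j < m" for j
      using sum_vanishing_at_nodes[OF y(3)] that by blast
    moreover have "x k \<in> X" using Suc.prems(2) k by (simp add: P_def)
    ultimately show ?case using a[rule_format, of "x k"] by simp
  qed
  from this[of m x] x show ?thesis by simp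
qed

section \<open>Linear closure of \<open>V n\<close> and genericity of \<open>tu\<close>\<close>

context nome begin

lemma theta_space_zero: "(\<lambda>_. 0) \<in> V n"
  by (simp add: theta_space_iff)

lemma theta_space_scale: "f \<in> V n \<Longrightarrow> (\<lambda>z. f z * c) \<in> V n"
  unfolding theta_space_iff
proof (elim conjE, intro conjI allI impI)
  fix x :: complex
  assume *: "\<forall>x. x \<noteq> 0 \<longrightarrow> f (p ^ 2 * x) = multiplier n x * f x \<and> f (inverse x) = - inverse x * f x \<and>
    f x + cbrt1 * f (cbrt1 * x) + cbrt1 ^ 2 * f (cbrt1 ^ 2 * x) = 0" and x: "x \<noteq> 0"
  have "f x * c + cbrt1 * (f (cbrt1 * x) * c) + cbrt1 ^ 2 * (f (cbrt1 ^ 2 * x) * c) =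
    (f x + cbrt1 * f (cbrt1 * x) + cbrt1 ^ 2 * f (cbrt1 ^ 2 * x)) * c" by (simp only: algebra_simps)
  then show "f x * c + cbrt1 * (f (cbrt1 * x) * c) + cbrt1 ^ 2 * (f (cbrt1 ^ 2 * x) * c) = 0"
    using * x by simp
qed (auto intro!: holomorphic_intros)

lemma theta_space_add: "f \<in> V n \<Longrightarrow> g \<in> V n \<Longrightarrow> (\<lambda>z. f z + g z) \<in> V n"
  unfolding theta_space_iff
proof (elim conjE, intro conjI allI impI)
  fix x :: complex
  assume *: "\<forall>x. x \<noteq> 0 \<longrightarrow> f (p ^ 2 * x) = multiplier n x * f x \<and> f (inverse x) = - inverse x * f x \<and>
    f x + cbrt1 * f (cbrt1 * x) + cbrt1 ^ 2 * f (cbrt1 ^ 2 * x) = 0"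
    "\<forall>x. x \<noteq> 0 \<longrightarrow> g (p ^ 2 * x) = multiplier n x * g x \<and> g (inverse x) = - inverse x * g x \<and>
    g x + cbrt1 * g (cbrt1 * x) + cbrt1 ^ 2 * g (cbrt1 ^ 2 * x) = 0" and x: "x \<noteq> 0"
  have "f x + g x + cbrt1 * (f (cbrt1 * x) + g (cbrt1 * x)) + cbrt1 ^ 2 * (f (cbrt1 ^ 2 * x) + g (cbrt1 ^ 2 * x)) =
    (f x + cbrt1 * f (cbrt1 * x) + cbrt1 ^ 2 * f (cbrt1 ^ 2 * x)) +
    (g x + cbrt1 * g (cbrt1 * x) + cbrt1 ^ 2 * g (cbrt1 ^ 2 * x))" by (simp only: algebra_simps)
  then show "f x + g x + cbrt1 * (f (cbrt1 * x) + g (cbrt1 * x)) + cbrt1 ^ 2 * (f (cbrt1 ^ 2 * x) + g (cbrt1 ^ 2 * x)) = 0"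
    using * x by simp
qed (auto intro!: holomorphic_intros simp: algebra_simps)

lemma theta_space_sum:
  "finite I \<Longrightarrow> (\<And>i. i \<in> I \<Longrightarrow> f i \<in> V n) \<Longrightarrow> (\<lambda>z. \<Sum>i\<in>I. f i z) \<in> V n"
  by (induction I rule: finite_induct) (auto intro: theta_space_zero theta_space_add)

lemma theta_space_mult_prod_tu:
  "finite K \<Longrightarrow> (\<And>k. k \<in> K \<Longrightarrow> u k \<noteq> 0) \<Longrightarrow> f \<in> V m \<Longrightarrow> (\<lambda>z. f z * (\<Prod>k\<in>K. tu z (u k))) \<in> V (m + card K)"
proof (induction K rule: finite_induct)
  case (insert a K)
  then have "(\<lambda>z. f z * (\<Prod>k\<in>K. tu z (u k)) * tu z (u a)) \<in> V (Suc (m + card K))"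
    by (intro theta_space_mult_tu) auto
  then show ?case using insert.hyps by (simp add: mult_ac)
qed simp

lemma generic_tu:
  assumes "a < m" "b < m" "a \<noteq> b"
  shows "generic m (\<lambda>x. tu (x a) (x b))"
proof -
  obtain s where s: "s \<noteq> 0" "jtheta (s ^ 6) (p ^ 6) \<noteq> 0" by (rule jtheta_sixth_power_nontrivial)
  obtain t where t: "t \<noteq> 0" "tu t s \<noteq> 0"
    using simple_at_nontrivial simple_at_tu[OF _ s] by blast
  have "(\<lambda>i. if i = a then t else s) \<in> nonzero_points m" using s t by (auto simp: nonzero_points_def)
  then have "\<exists>x\<in>nonzero_points m. tu (x a) (x b) \<noteq> 0"
    using t assms by (intro bexI[of _ "\<lambda>i. if i = a then t else s"]) auto
  moreover have "(\<lambda>z. tu ((x(k := z)) a) ((x(k := z)) b)) holomorphic_on - {0}"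
    if "x \<in> nonzero_points m" "k < m" for x k
  proof (rule holomorphic_tu)
    show "(\<lambda>z. (x(k := z)) a) holomorphic_on - {0}" by (cases "a = k") (auto intro!: holomorphic_intros)
    show "(\<lambda>z. (x(k := z)) b) holomorphic_on - {0}" by (cases "b = k") (auto intro!: holomorphic_intros)
  qed (use that assms in \<open>auto simp: nonzero_points_def\<close>)
  ultimately show ?thesis unfolding generic_def using assms by auto
qed

end

section \<open>The numerator of the determinant formula\<close>

locale nome_basis = nome +
  fixes \<psi> :: "nat \<Rightarrow> complex \<Rightarrow> complex"
  assumes \<psi>: "basis_family (theta_space p 1) 3 \<psi>"
begin

abbreviation Ps where "Ps \<equiv> Psi1 \<psi>"

lemma basis_in_V: "j < 3 \<Longrightarrow> \<psi> j \<in> V 1"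
  using basis_family_in[OF \<psi>] .

lemma Psi1_swap12: "Ps b a c = - Ps a b c"
proof -
  have "det (mat 3 3 (\<lambda>(i, j). \<psi> j ([b, a, c] ! i))) =
      det (mat 3 3 (\<lambda>(i, j). \<psi> j ([a, b, c] ! (Transposition.transpose 0 1 i))))"
    by (rule det_mat_cong) (auto simp: less_Suc_eq numeral_3_eq_3 Transposition.transpose_def)
  also have "\<dots> = of_int (sign (Transposition.transpose 0 (1 :: nat))) * det (mat 3 3 (\<lambda>(i, j). \<psi> j ([a, b, c] ! i)))"
    by (rule det_mat_permute_rows) (auto intro!: permutes_swap_id)
  finally show ?thesis by (simp add: Psi1_def sign_swap_id)
qed

lemma Psi1_swap23: "Ps a c b = - Ps a b c"
proof -
  have "det (mat 3 3 (\<lambda>(i, j). \<psi> j ([a, c, b] ! i))) =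
      det (mat 3 3 (\<lambda>(i, j). \<psi> j ([a, b, c] ! (Transposition.transpose 1 2 i))))"
    by (rule det_mat_cong) (auto simp: less_Suc_eq numeral_3_eq_3 numeral_2_eq_2 Transposition.transpose_def)
  also have "\<dots> = of_int (sign (Transposition.transpose 1 (2 :: nat))) * det (mat 3 3 (\<lambda>(i, j). \<psi> j ([a, b, c] ! i)))"
    by (rule det_mat_permute_rows) (auto intro!: permutes_swap_id)
  finally show ?thesis by (simp add: Psi1_def sign_swap_id)
qed

lemma Psi1_eq_0: "Ps a a c = 0" "Ps a b b = 0" "Ps a b a = 0"
  using Psi1_swap12[of a a c] Psi1_swap23[of a b b] Psi1_swap12[of a b a] Psi1_swap23[of b a a] by auto

lemma Psi1_in_V: "(\<lambda>z. Ps z b c) \<in> V 1"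
proof -
  obtain k where k: "\<And>r. det (mat 3 3 (\<lambda>(i, j). if i = 0 then r j else \<psi> j ([0, b, c] ! i))) = (\<Sum>j<3. r j * k j)"
    using det_mat_expand_row[of 0 3 "\<lambda>i j. \<psi> j ([0, b, c] ! i)"] by auto
  have "Ps z b c = det (mat 3 3 (\<lambda>(i, j). if i = 0 then \<psi> j z else \<psi> j ([0, b, c] ! i)))" for z
    unfolding Psi1_def by (rule det_mat_cong) (auto simp: less_Suc_eq numeral_3_eq_3)
  then have "Ps z b c = (\<Sum>j<3. \<psi> j z * k j)" for z by (simp only: k)
  moreover have "(\<lambda>z. \<Sum>j<3. \<psi> j z * k j) \<in> V 1"
    by (intro theta_space_sum theta_space_scale basis_in_V) auto
  ultimately show ?thesis by simp
qed

text \<open>The coordinates of \<open>h\<close> solve a homogeneous linear system with determinant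
  \<open>Ps a b c\<close>.\<close>

lemma theta_space_1_eq_0:
  assumes h: "h \<in> V 1" and nz: "Ps a b c \<noteq> 0" and 0: "h a = 0" "h b = 0" "h c = 0"
  shows "h z = 0"
proof -
  obtain k where k: "\<And>z. h z = (\<Sum>j<3. k j * \<psi> j z)"
    using basis_family_sum[OF \<psi> h] by blast
  have "(\<Sum>j<3. k j * \<psi> j ([a, b, c] ! i)) = 0" if "i < 3" for i
    using that 0 unfolding k[symmetric] by (auto simp: less_Suc_eq numeral_3_eq_3)
  then have "k j = 0" if "j < 3" for j
    using sum_vanishing_at_nodes[of 3 \<psi> "\<lambda>i. [a, b, c] ! i" k] nz that by (simp add: Psi1_def)
  then show ?thesis by (simp add: k)
qed

lemma continuous_on_Psi1:
  assumes "continuous_on A f" "continuous_on A g" "continuous_on A h"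
    and "\<And>x. x \<in> A \<Longrightarrow> f x \<noteq> 0" "\<And>x. x \<in> A \<Longrightarrow> g x \<noteq> 0" "\<And>x. x \<in> A \<Longrightarrow> h x \<noteq> 0"
  shows "continuous_on A (\<lambda>x. Ps (f x) (g x) (h x))"
  unfolding Psi1_def
proof (rule continuous_on_det)
  fix i j :: nat assume "i < 3" "j < 3"
  then have c: "continuous_on (- {0}) (\<psi> j)"
    using basis_in_V theta_space_holomorphic holomorphic_on_imp_continuous_on by blast
  consider "i = 0" | "i = 1" | "i = 2" using \<open>i < 3\<close> by linarith
  then show "continuous_on A (\<lambda>x. \<psi> j ([f x, g x, h x] ! i))"
    by cases (use assms(4-6) in \<open>auto intro!: continuous_on_compose2[OF c] assms(1-3)\<close>)
qed

lemma generic_Psi1: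
  assumes "a < m" "b < m" "c < m" "a \<noteq> b" "a \<noteq> c" "b \<noteq> c"
  shows "generic m (\<lambda>x. Ps (x a) (x b) (x c))"
proof -
  obtain y where y: "det (mat 3 3 (\<lambda>(i, j). \<psi> j (y i))) \<noteq> 0"
    using basis_family_nodes[OF \<psi>] by blast
  have "det (mat 3 3 (\<lambda>(i, j). \<psi> j (y i))) = Ps (y 0) (y 1) (y 2)"
    unfolding Psi1_def by (rule det_mat_cong) (auto simp: less_Suc_eq numeral_3_eq_3 numeral_2_eq_2)
  with y have Py: "Ps (y 0) (y 1) (y 2) \<noteq> 0" by simp
  \<comment> \<open>Members of \<open>V 1\<close> are normalised to vanish at the origin, so a node
    there would produce a zero row.\<close>
  have "y i \<noteq> 0" if "i < 3" for i
  proof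
    assume "y i = 0"
    then have "det (mat 3 3 (\<lambda>(i, j). \<psi> j (y i))) = 0"
      using that basis_in_V by (intro det_mat_zero_row[of i]) (auto simp: theta_space_iff)
    with y show False by simp
  qed
  then have nz: "y 0 \<noteq> 0" "y 1 \<noteq> 0" "y 2 \<noteq> 0" by auto
  let ?x = "\<lambda>i. if i = a then y 0 else if i = b then y 1 else y 2"
  have "?x \<in> nonzero_points m" using nz by (auto simp: nonzero_points_def)
  then have "\<exists>x\<in>nonzero_points m. Ps (x a) (x b) (x c) \<noteq> 0"
    using Py assms by (intro bexI[of _ ?x]) auto
  moreover have "(\<lambda>z. Ps ((x(k := z)) a) ((x(k := z)) b) ((x(k := z)) c)) holomorphic_on - {0}"
    if "x \<in> nonzero_points m" "k < m" for x k
  proof -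
    have *: "(\<lambda>z. Ps z b' c') holomorphic_on - {0}" for b' c'
      by (rule theta_space_holomorphic[OF Psi1_in_V])
    consider "k = a" | "k = b" | "k = c" | "k \<notin> {a, b, c}" by blast
    then show ?thesis
    proof cases
      case 1
      then show ?thesis using assms * by simp
    next
      case 2
      have "(\<lambda>z. - Ps z (x a) (x c)) holomorphic_on - {0}" by (intro holomorphic_on_minus *)
      then show ?thesis using 2 assms by (simp flip: Psi1_swap12)
    next
      case 3
      have "Ps (x a) (x b) z = Ps z (x a) (x b)" for z
        using Psi1_swap12[of "x a" z "x b"] Psi1_swap23[of "x a" "x b" z] by simp
      then show ?thesis using 3 assms * by simp
    qed auto
  qed
  ultimately show ?thesis unfolding generic_def using assms by auto
qed

text \<open>As a function of \<open>v\<close> this lies in \<open>V 1\<close> and vanishes at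
  \<open>s\<close> and \<open>cbrt1 * s\<close>. Dividing by \<open>tu v s\<close> leaves an element
  of \<open>V 0\<close>, a multiple of \<open>w\<close>.\<close>

lemma Psi1_cbrt1:
  assumes s: "s \<noteq> 0" "jtheta (s ^ 6) (p ^ 6) \<noteq> 0"
  obtains c where "\<And>v. v \<noteq> 0 \<Longrightarrow> Ps (cbrt1 * s) s v = c * (w v * tu v s)"
proof -
  have eq: "Ps (cbrt1 * s) s v = Ps v (cbrt1 * s) s" for v
    using Psi1_swap12[of "cbrt1 * s" v s] Psi1_swap23[of "cbrt1 * s" s v] by simp
  have V1: "(\<lambda>z. Ps z (cbrt1 * s) s) \<in> V (Suc 0)" using Psi1_in_V by simp
  obtain h where h: "h \<in> V 0" "\<And>z. z \<noteq> 0 \<Longrightarrow> Ps z (cbrt1 * s) s = h z * tu z s"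
    using theta_space_divide[OF V1 s(1) _ _ s(2)] by (auto simp: Psi1_eq_0)
  obtain c where "\<And>z. z \<noteq> 0 \<Longrightarrow> h z = c * w z" using theta_space_0_eq[OF h(1)] by blast
  then show ?thesis using h(2) by (intro that[of c]) (simp add: eq)
qed

text \<open>
  \<open>G n t u v\<close> is the numerator of \<open>\<Psi>\<^sub>n\<close>: the product over \<open>t\<close> and \<open>u\<close> has been
  absorbed into the rows of the determinant, which makes the entries holomorphic.
\<close>

definition G :: "nat \<Rightarrow> (nat \<Rightarrow> complex) \<Rightarrow> (nat \<Rightarrow> complex) \<Rightarrow> complex \<Rightarrow> complex" where
  "G n t u v = det (mat n n (\<lambda>(i, j). Ps (t i) (u j) v * (\<Prod>k\<in>{..<n} - {j}. tu (t i) (u k))))"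

lemma G_cong:
  assumes "\<And>i. i < n \<Longrightarrow> t i = t' i" "\<And>i. i < n \<Longrightarrow> u i = u' i"
  shows "G n t u v = G n t' u' v"
  unfolding G_def
proof (rule det_mat_cong)
  fix i j assume "i < n" "j < n"
  moreover have "(\<Prod>k\<in>{..<n} - {j}. tu (t i) (u k)) = (\<Prod>k\<in>{..<n} - {j}. tu (t' i) (u' k))"
    by (rule prod.cong) (use assms \<open>i < n\<close> in auto)
  ultimately show "Ps (t i) (u j) v * (\<Prod>k\<in>{..<n} - {j}. tu (t i) (u k)) =
      Ps (t' i) (u' j) v * (\<Prod>k\<in>{..<n} - {j}. tu (t' i) (u' k))"
    using assms by simp
qed

text \<open>Row \<open>a\<close> is zero: its entry in column \<open>j\<close> has a repeated
  argument of \<open>Ps\<close>, and every other entry contains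
  \<open>tu (u j) (u j)\<close>.\<close>

lemma G_eq_0_tu:
  assumes "a < n" "j < n" "t a = u j" "u j \<noteq> 0"
  shows "G n t u v = 0"
  unfolding G_def
proof (rule det_mat_zero_row[OF assms(1)])
  fix l assume "l < n"
  show "Ps (t a) (u l) v * (\<Prod>k\<in>{..<n} - {l}. tu (t a) (u k)) = 0"
  proof (cases "l = j")
    case False
    have "(\<Prod>k\<in>{..<n} - {l}. tu (t a) (u k)) = 0"
      by (rule prod_zero) (use False assms tu_diag in \<open>auto intro!: bexI[of _ j]\<close>)
    then show ?thesis by simp
  qed (use assms in \<open>simp add: Psi1_eq_0\<close>)
qed

lemma G_eq_0_tv:
  assumes "a < n" "t a = v"
  shows "G n t u v = 0"
  unfolding G_def by (rule det_mat_zero_row[OF assms(1)]) (simp add: assms Psi1_eq_0)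

lemma G_eq_0_tt:
  assumes "a < n" "b < n" "a \<noteq> b" "t a = t b"
  shows "G n t u v = 0"
  unfolding G_def by (rule det_mat_equal_rows[OF assms(1,2,3)]) (simp add: assms)

text \<open>The determinant is linear in row \<open>a\<close>, whose entries are elements of
  \<open>V 1\<close> times \<open>n - 1\<close> factors \<open>tu\<close>.\<close>

lemma G_in_V:
  assumes "a < n" "\<And>j. j < n \<Longrightarrow> u j \<noteq> 0"
  shows "(\<lambda>z. G n (t(a := z)) u v) \<in> V n"
proof -
  define e where "e s j = Ps s (u j) v * (\<Prod>k\<in>{..<n} - {j}. tu s (u k))" for s j
  obtain c where c: "\<And>r. det (mat n n (\<lambda>(i, j). if i = a then r j else e (t i) j)) = (\<Sum>j<n. r j * c j)"
    using det_mat_expand_row[OF assms(1), of "\<lambda>i j. e (t i) j"] by auto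
  have "G n (t(a := z)) u v = det (mat n n (\<lambda>(i, j). if i = a then e z j else e (t i) j))" for z
    unfolding G_def e_def by (rule det_mat_cong) auto
  then have "G n (t(a := z)) u v = (\<Sum>j<n. e z j * c j)" for z by (simp only: c)
  moreover have "(\<lambda>z. e z j) \<in> V n" if "j < n" for j
  proof -
    have "(\<lambda>z. e z j) \<in> V (1 + card ({..<n} - {j}))"
      unfolding e_def by (rule theta_space_mult_prod_tu[OF _ _ Psi1_in_V]) (use assms in auto)
    moreover have "1 + card ({..<n} - {j}) = n" using that by simp
    ultimately show ?thesis by (simp only:)
  qed
  then have "(\<lambda>z. \<Sum>j<n. e z j * c j) \<in> V n"
    by (intro theta_space_sum theta_space_scale) auto
  ultimately show ?thesis by simp
qed

lemma continuous_on_G: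
  assumes "\<And>i. i < n \<Longrightarrow> continuous_on A (\<lambda>x. t x i)" "\<And>i. i < n \<Longrightarrow> continuous_on A (\<lambda>x. u x i)"
    "continuous_on A v"
    and "\<And>x i. x \<in> A \<Longrightarrow> i < n \<Longrightarrow> t x i \<noteq> 0" "\<And>x i. x \<in> A \<Longrightarrow> i < n \<Longrightarrow> u x i \<noteq> 0" "\<And>x. x \<in> A \<Longrightarrow> v x \<noteq> 0"
  shows "continuous_on A (\<lambda>x. G n (t x) (u x) (v x))"
  unfolding G_def
  by (intro continuous_on_det continuous_on_mult continuous_on_prod continuous_on_Psi1 continuous_on_tu)
     (use assms in auto)

text \<open>In the last row only column \<open>l\<close> can survive, since all other entries
  contain \<open>tu (cbrt1 * u l) (u l)\<close>, which is 0. Each row of the remaining minor has the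
  common factor \<open>tu (t i) (u l)\<close>, and what is left is the smaller numerator with
  \<open>u l\<close> omitted.\<close>

lemma G_cbrt1:
  assumes l: "l \<le> n" "t n = cbrt1 * u l" "u l \<noteq> 0"
  shows "G (Suc n) t u v = Ps (cbrt1 * u l) (u l) v * (\<Prod>k\<in>{..<Suc n} - {l}. tu (u l) (u k)) *
    ((- 1) ^ (n + l) * ((\<Prod>i<n. tu (t i) (u l)) * G n t (\<lambda>k. u (if k < l then k else Suc k)) v))"
proof -
  let ?s = "\<lambda>k. if k < l then k else Suc k"
  let ?a = "\<lambda>i j. Ps (t i) (u j) v * (\<Prod>k\<in>{..<Suc n} - {j}. tu (t i) (u k))"
  have "G (Suc n) t u v = ?a n l * ((- 1) ^ (n + l) * det (mat n n (\<lambda>(i, j). ?a i (?s j))))"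
    unfolding G_def
  proof (rule det_mat_single_entry_row[OF l(1)])
    fix j assume j: "j \<le> n" "j \<noteq> l"
    have "(\<Prod>k\<in>{..<Suc n} - {j}. tu (t n) (u k)) = 0"
      by (rule prod_zero) (use l j tu_diag in \<open>auto intro!: bexI[of _ l] simp: tu_cbrt1\<close>)
    then show "?a n j = 0" by simp
  qed
  also have "det (mat n n (\<lambda>(i, j). ?a i (?s j))) =
    det (mat n n (\<lambda>(i, j). tu (t i) (u l) * (Ps (t i) (u (?s j)) v * (\<Prod>k\<in>{..<n} - {j}. tu (t i) (u (?s k))))))"
  proof (rule det_mat_cong)
    fix i j assume ij: "i < n" "j < n"
    \<comment> \<open>The columns other than that of the minor's index \<open>j\<close> are the
      deleted column \<open>l\<close> and the renumbered remaining ones.\<close>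
    have set: "{..<Suc n} - {?s j} = insert l (?s ` ({..<n} - {j}))"
    proof (intro equalityI subsetI)
      fix k assume k: "k \<in> {..<Suc n} - {?s j}"
      consider "k = l" | "k < l" | "k > l" by linarith
      then show "k \<in> insert l (?s ` ({..<n} - {j}))"
      proof cases
        case 2
        then have "k = ?s k" "k \<in> {..<n} - {j}" using k l(1) by (auto split: if_splits)
        then show ?thesis by blast
      next
        case 3
        then have "k = ?s (k - 1)" "k - 1 \<in> {..<n} - {j}" using k l(1) ij by (auto split: if_splits)
        then show ?thesis by blast
      qed simp
    qed (use l(1) ij in \<open>auto split: if_splits\<close>)
    have "inj_on ?s ({..<n} - {j})" by (auto simp: inj_on_def split: if_splits)
    then have "(\<Prod>k\<in>?s ` ({..<n} - {j}). tu (t i) (u k)) = (\<Prod>k\<in>{..<n} - {j}. tu (t i) (u (?s k)))"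
      by (subst prod.reindex) (simp_all only: o_def)
    moreover have "l \<notin> ?s ` ({..<n} - {j})" by (auto split: if_splits)
    then have "(\<Prod>k\<in>insert l (?s ` ({..<n} - {j})). tu (t i) (u k)) =
      tu (t i) (u l) * (\<Prod>k\<in>?s ` ({..<n} - {j}). tu (t i) (u k))"
      by (intro prod.insert) auto
    ultimately have "(\<Prod>k\<in>{..<Suc n} - {?s j}. tu (t i) (u k)) =
      tu (t i) (u l) * (\<Prod>k\<in>{..<n} - {j}. tu (t i) (u (?s k)))"
      unfolding set by (simp only:)
    then show "?a i (?s j) = tu (t i) (u l) * (Ps (t i) (u (?s j)) v * (\<Prod>k\<in>{..<n} - {j}. tu (t i) (u (?s k))))"
      by (simp add: mult_ac)
  qed
  also have "\<dots> = (\<Prod>i<n. tu (t i) (u l)) * G n t (\<lambda>k. u (?s k)) v"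
    unfolding G_def by (rule det_mat_scale_rows)
  finally show ?thesis by (simp add: l(2) tu_cbrt1)
qed

section \<open>Exchange of a variable \<open>u i\<close> with \<open>v\<close> in the
  numerator\<close>

lemma G_Suc_0: "G (Suc 0) t u v = Ps (t 0) (u 0) v"
  unfolding G_def by (subst det_mat_single_entry_row[where l = 0]) (simp_all add: lessThan_Suc)

text \<open>The induction step for \<open>G_swap\<close>, under conditions that make the divisions
  by theta factors legitimate and \<open>Ps\<close> nonzero at the three final zeros.\<close>

lemma G_swap_generic:
  assumes IH: "\<And>t u v i. i \<le> n \<Longrightarrow> (\<And>k. k \<le> n \<Longrightarrow> t k \<noteq> 0 \<and> u k \<noteq> 0) \<Longrightarrow> v \<noteq> 0 \<Longrightarrow>
      G (Suc n) t u v * w (u i) ^ n + G (Suc n) t (u(i := v)) (u i) * w v ^ n = 0"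
    and i: "i \<le> Suc n" and nz: "\<And>k. k \<le> Suc n \<Longrightarrow> t k \<noteq> 0 \<and> u k \<noteq> 0" "v \<noteq> 0"
    and th: "\<And>k. k \<le> Suc n \<Longrightarrow> jtheta (u k ^ 6) (p ^ 6) \<noteq> 0"
    and uu: "\<And>j k. j \<le> Suc n \<Longrightarrow> k \<le> Suc n \<Longrightarrow> j \<noteq> k \<Longrightarrow> tu (u j) (u k) \<noteq> 0"
    and vu: "\<And>k. k \<le> Suc n \<Longrightarrow> tu v (u k) \<noteq> 0" and t0u: "\<And>k. k \<le> Suc n \<Longrightarrow> tu (t 0) (u k) \<noteq> 0"
    and ps: "Ps (u i) v (t 0) \<noteq> 0"
  shows "G (Suc (Suc n)) t u v * w (u i) ^ Suc n + G (Suc (Suc n)) t (u(i := v)) (u i) * w v ^ Suc n = 0"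
proof -
  let ?N = "Suc (Suc n)"
  \<comment> \<open>The sum to be annihilated, as a function of the last \<open>t\<close> variable,
    which has index \<open>Suc n\<close>.\<close>
  define f where "f z = G ?N (t(Suc n := z)) u v * w (u i) ^ Suc n +
    G ?N (t(Suc n := z)) (u(i := v)) (u i) * w v ^ Suc n" for z
  define J where "J = {..Suc n} - {i}"
  have J: "finite J" "card J = Suc n" using i by (auto simp: J_def)
  have "f \<in> V (1 + card J)"
    unfolding f_def J by (simp only: plus_1_eq_Suc)
      (intro theta_space_add theta_space_scale G_in_V; use nz in \<open>auto simp: less_Suc_eq_le\<close>)
  moreover have "u j \<noteq> 0 \<and> f (u j) = 0 \<and> f (cbrt1 * u j) = 0 \<and> jtheta (u j ^ 6) (p ^ 6) \<noteq> 0" if j: "j \<in> J" for j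
  proof (intro conjI)
    have jle: "j \<le> Suc n" "j \<noteq> i" using j by (auto simp: J_def)
    show uj: "u j \<noteq> 0" "jtheta (u j ^ 6) (p ^ 6) \<noteq> 0" using nz th jle by auto
    have "G ?N (t(Suc n := u j)) u v = 0"
      by (rule G_eq_0_tu[of "Suc n" _ j]) (use jle uj in auto)
    moreover have "G ?N (t(Suc n := u j)) (u(i := v)) (u i) = 0"
      by (rule G_eq_0_tu[of "Suc n" _ j]) (use jle uj in auto)
    ultimately show "f (u j) = 0" by (simp add: f_def)
    \<comment> \<open>The last \<open>t\<close> variable is placed at \<open>cbrt1 * u j\<close>.
      The list \<open>us\<close> omits \<open>u j\<close>, and \<open>i'\<close> is the position of
      \<open>u i\<close> in it.\<close>
    define t' where "t' = t(Suc n := cbrt1 * u j)"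
    define us where "us k = u (if k < j then k else Suc k)" for k
    define i' where "i' = (if i < j then i else i - 1)"
    have i': "i' \<le> n" "(if i' < j then i' else Suc i') = i"
      using i jle by (auto simp: i'_def)
    have us: "us i' = u i" unfolding us_def i'(2) ..
    have upd: "(\<lambda>k. (u(i := v)) (if k < j then k else Suc k)) = us(i' := v)"
    proof
      fix k
      have "(if k < j then k else Suc k) = i \<longleftrightarrow> k = i'" using i'(2) by (auto split: if_splits)
      then show "(u(i := v)) (if k < j then k else Suc k) = (us(i' := v)) k"
        by (simp only: fun_upd_apply us_def)
    qed
    define g1 g2 where "g1 = G (Suc n) t' us v" and "g2 = G (Suc n) t' (us(i' := v)) (u i)"
    have ih: "g1 * w (u i) ^ n + g2 * w v ^ n = 0"
      unfolding g1_def g2_def us[symmetric]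
      by (rule IH) (use i' nz in \<open>auto simp: t'_def us_def\<close>)
    obtain c where c: "\<And>v. v \<noteq> 0 \<Longrightarrow> Ps (cbrt1 * u j) (u j) v = c * (w v * tu v (u j))"
      using Psi1_cbrt1[OF uj] by blast
    \<comment> \<open>The factor with index \<open>i\<close> is split off: it is the only one
      affected when \<open>u i\<close> is replaced by \<open>v\<close>.\<close>
    define B where "B = (\<Prod>k\<in>{..<?N} - {j} - {i}. tu (u j) (u k))"
    have iN: "i \<in> {..<?N} - {j}" using i jle by auto
    have B1: "(\<Prod>k\<in>{..<?N} - {j}. tu (u j) (u k)) = - tu (u i) (u j) * B"
      using prod.remove[OF _ iN, of "\<lambda>k. tu (u j) (u k)"] tu_antisym[of "u i" "u j"] nz i jle
      by (simp add: B_def)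
    have "(\<Prod>k\<in>{..<?N} - {j} - {i}. tu (u j) ((u(i := v)) k)) = B"
      unfolding B_def by (rule prod.cong) auto
    then have B2: "(\<Prod>k\<in>{..<?N} - {j}. tu (u j) ((u(i := v)) k)) = - tu v (u j) * B"
      using prod.remove[OF _ iN, of "\<lambda>k. tu (u j) ((u(i := v)) k)"] tu_antisym[of v "u j"] nz jle
      by simp
    define R where "R = (- 1) ^ (Suc n + j) * (\<Prod>a<Suc n. tu (t' a) (u j))"
    have "G ?N t' u v = Ps (cbrt1 * u j) (u j) v * (\<Prod>k\<in>{..<?N} - {j}. tu (u j) (u k)) *
        ((- 1) ^ (Suc n + j) * ((\<Prod>a<Suc n. tu (t' a) (u j)) * G (Suc n) t' us v))"
      unfolding us_def by (rule G_cbrt1) (use jle uj in \<open>auto simp: t'_def\<close>)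
    then have e1: "G ?N t' u v = c * (w v * tu v (u j)) * (- tu (u i) (u j) * B) * (R * g1)"
      unfolding B1 c[OF nz(2)] R_def g1_def by (simp only: mult_ac)
    have ci: "Ps (cbrt1 * u j) (u j) (u i) = c * (w (u i) * tu (u i) (u j))"
      using c nz(1)[OF i] by blast
    have uij: "(u(i := v)) j = u j" using jle by simp
    have "G ?N t' (u(i := v)) (u i) =
        Ps (cbrt1 * (u(i := v)) j) ((u(i := v)) j) (u i) * (\<Prod>k\<in>{..<?N} - {j}. tu ((u(i := v)) j) ((u(i := v)) k)) *
        ((- 1) ^ (Suc n + j) * ((\<Prod>a<Suc n. tu (t' a) ((u(i := v)) j)) *
          G (Suc n) t' (\<lambda>k. (u(i := v)) (if k < j then k else Suc k)) (u i)))"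
      by (rule G_cbrt1) (use jle uj in \<open>auto simp: t'_def\<close>)
    then have e2: "G ?N t' (u(i := v)) (u i) = c * (w (u i) * tu (u i) (u j)) * (- tu v (u j) * B) * (R * g2)"
      unfolding uij upd B2 R_def g2_def ci by (simp only: mult_ac)
    \<comment> \<open>Each term supplies one factor \<open>w\<close> from \<open>Psi1_cbrt1\<close>
      and one from its own power. Extracting \<open>w v * w (u i)\<close> lowers the exponents to
      \<open>n\<close>, which leaves the induction hypothesis.\<close>
    have "f (cbrt1 * u j) = - (c * tu v (u j) * tu (u i) (u j) * B * R * w v * w (u i)) *
        (g1 * w (u i) ^ n + g2 * w v ^ n)"
      unfolding f_def t'_def[symmetric] e1 e2 by (simp add: algebra_simps)
    then show "f (cbrt1 * u j) = 0" by (simp add: ih)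
  qed
  moreover have "tu (u j) (u k) \<noteq> 0" if "j \<in> J" "k \<in> J" "j \<noteq> k" for j k
    using that by (intro uu) (auto simp: J_def)
  ultimately obtain h where h: "h \<in> V 1" "\<And>z. z \<noteq> 0 \<Longrightarrow> f z = h z * (\<Prod>j\<in>J. tu z (u j))"
    using theta_space_divide_prod[OF J(1), of f 1 u] by blast
  \<comment> \<open>The quotient \<open>h\<close> has zeros at \<open>u i\<close>, \<open>v\<close>
    and \<open>t 0\<close>. At the first two, one term of \<open>f\<close> has a coincidence of
    \<open>t\<close> with some \<open>u\<close> and the other one of \<open>t\<close> with the last
    argument; at the third, two \<open>t\<close> variables coincide.\<close>
  have "G ?N (t(Suc n := u i)) u v = 0"
    by (rule G_eq_0_tu[of "Suc n" _ i]) (use i nz in auto)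
  moreover have "G ?N (t(Suc n := u i)) (u(i := v)) (u i) = 0"
    by (rule G_eq_0_tv[of "Suc n"]) auto
  ultimately have "f (u i) = 0" by (simp add: f_def)
  moreover have "(\<Prod>j\<in>J. tu (u i) (u j)) \<noteq> 0" using uu i J(1) by (auto simp: J_def)
  ultimately have h1: "h (u i) = 0" using h(2)[of "u i"] nz i by auto
  have "G ?N (t(Suc n := v)) (u(i := v)) (u i) = 0"
    by (rule G_eq_0_tu[of "Suc n" _ i]) (use i nz in auto)
  moreover have "G ?N (t(Suc n := v)) u v = 0"
    by (rule G_eq_0_tv[of "Suc n"]) auto
  ultimately have "f v = 0" by (simp add: f_def)
  moreover have "(\<Prod>j\<in>J. tu v (u j)) \<noteq> 0" using vu J(1) by (auto simp: J_def)
  ultimately have h2: "h v = 0" using h(2)[of v] nz by auto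
  have "G ?N (t(Suc n := t 0)) u' v' = 0" for u' v'
    by (rule G_eq_0_tt[of 0 _ "Suc n"]) auto
  then have "f (t 0) = 0" by (simp add: f_def)
  moreover have "(\<Prod>j\<in>J. tu (t 0) (u j)) \<noteq> 0" using t0u J(1) by (auto simp: J_def)
  ultimately have h3: "h (t 0) = 0" using h(2)[of "t 0"] nz by auto
  have "f (t (Suc n)) = 0"
    using h(2)[of "t (Suc n)"] nz(1)[of "Suc n"] theta_space_1_eq_0[OF h(1) ps h1 h2 h3] by simp
  then show ?thesis by (simp only: f_def fun_upd_triv)
qed

lemma continuous_on_coordinate: "continuous_on A (\<lambda>x :: nat \<Rightarrow> complex. x i)"
  by (rule continuous_on_subset[OF continuous_on_product_coordinates]) simp

text \<open>Induction on \<open>n\<close>: the base case is antisymmetry of \<open>Ps\<close>, and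
  the step passes from generic points to all points by continuity.\<close>

lemma G_swap:
  "i \<le> n \<Longrightarrow> (\<And>k. k \<le> n \<Longrightarrow> t k \<noteq> 0 \<and> u k \<noteq> 0) \<Longrightarrow> v \<noteq> 0 \<Longrightarrow>
    G (Suc n) t u v * w (u i) ^ n + G (Suc n) t (u(i := v)) (u i) * w v ^ n = 0"
proof (induction n arbitrary: t u v i)
  case 0
  then show ?case using Psi1_swap23[of "t 0" v "u 0"] by (simp add: G_Suc_0)
next
  case (Suc n)
  define N where "N = Suc (Suc n)"
  define m where "m = 2 * N + 1"
  define S where "S x = G N x (\<lambda>j. x (N + j)) (x (2 * N)) * w (x (N + i)) ^ Suc n +
    G N x ((\<lambda>j. x (N + j))(i := x (2 * N))) (x (N + i)) * w (x (2 * N)) ^ Suc n" for x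
  \<comment> \<open>The product of everything that \<open>G_swap_generic\<close> requires to be
    nonzero, with all variables packed into one point.\<close>
  define Q where "Q x = (\<Prod>j<N. jtheta (x (N + j) ^ 6) (p ^ 6)) *
    (\<Prod>a<m. \<Prod>b\<in>{..<m} - {a}. tu (x a) (x b)) * Ps (x (N + i)) (x (2 * N)) (x 0)" for x
  have iN: "i < N" using Suc.prems(1) by (simp add: N_def)
  have nzm: "x k \<noteq> 0" if "x \<in> nonzero_points m" "k < m" for x k
    using that by (simp add: nonzero_points_def)
  have "continuous_on (nonzero_points m) (\<lambda>x. ((\<lambda>j. x (N + j))(i := x (2 * N))) k)" for k
    by (cases "k = i") (auto intro: continuous_on_coordinate)
  then have cont: "continuous_on (nonzero_points m) S"
    unfolding S_def
    by (intro continuous_on_add continuous_on_mult continuous_on_power continuous_on_w continuous_on_G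
        continuous_on_coordinate) (use iN in \<open>auto simp: nonzero_points_def m_def\<close>)
  have gen: "generic m Q"
  proof -
    obtain s where s: "s \<noteq> 0" "jtheta (s ^ 6) (p ^ 6) \<noteq> 0" by (rule jtheta_sixth_power_nontrivial)
    have "(\<lambda>z. jtheta (z ^ 6) (p ^ 6)) holomorphic_on - {0}"
      by (rule holomorphic_jtheta[OF nome6(1)]) (auto intro!: holomorphic_intros)
    then have "generic m (\<lambda>x. jtheta (x (N + j) ^ 6) (p ^ 6))" if "j < N" for j
      by (rule generic_coordinate[where F = "\<lambda>z. jtheta (z ^ 6) (p ^ 6)" and b = s]) (use s that in \<open>auto simp: m_def\<close>)
    then show ?thesis
      unfolding Q_def
      by (intro generic_mult generic_prod generic_tu generic_Psi1)
         (use iN in \<open>auto simp: m_def N_def\<close>)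
  qed
  have van: "S x = 0" if x: "x \<in> nonzero_points m" "Q x \<noteq> 0" for x
  proof -
    have th: "jtheta (x (N + j) ^ 6) (p ^ 6) \<noteq> 0" if "j < N" for j
      using x(2) that by (auto simp: Q_def)
    have tux: "tu (x a) (x b) \<noteq> 0" if "a < m" "b < m" "a \<noteq> b" for a b
    proof
      assume "tu (x a) (x b) = 0"
      then have "(\<Prod>b\<in>{..<m} - {a}. tu (x a) (x b)) = 0"
        using that by (intro prod_zero) auto
      then have "(\<Prod>a<m. \<Prod>b\<in>{..<m} - {a}. tu (x a) (x b)) = 0"
        using that by (intro prod_zero) auto
      then show False using x(2) by (simp add: Q_def)
    qed
    show ?thesis
      unfolding S_def N_def
    proof (rule G_swap_generic[of n i x "\<lambda>j. x (Suc (Suc n) + j)" "x (2 * Suc (Suc n))"], goal_cases)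
      case (1 t u v i)
      then show ?case by (rule Suc.IH)
    next
      case (3 k)
      then show ?case using nzm[OF x(1)] by (auto simp: m_def N_def)
    next
      case (5 k)
      then show ?case using th[of k] by (simp add: N_def)
    next
      case (6 j k)
      then show ?case by (intro tux) (auto simp: m_def N_def)
    next
      case (7 k)
      then show ?case by (intro tux) (auto simp: m_def N_def)
    next
      case (8 k)
      then show ?case by (intro tux) (auto simp: m_def N_def)
    qed (use Suc.prems(1) x nzm[OF x(1)] in \<open>auto simp: Q_def m_def N_def\<close>)
  qed
  define y where "y k = (if k < N then t k else if k < 2 * N then u (k - N) else v)" for k
  have ymem: "y \<in> nonzero_points m"
    using Suc.prems by (auto simp: nonzero_points_def y_def N_def)
  have "S y = 0" by (rule generic_imp_eq_0[OF cont gen _ ymem]) (rule van)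
  moreover have "G N y (\<lambda>j. y (N + j)) (y (2 * N)) = G N t u v"
    unfolding y_def by (simp, rule G_cong) auto
  moreover have "G N y ((\<lambda>j. y (N + j))(i := y (2 * N))) (y (N + i)) = G N t (u(i := v)) (u i)"
    unfolding y_def using iN by (simp, intro G_cong) auto
  moreover have "y (N + i) = u i" "y (2 * N) = v" using iN by (auto simp: y_def)
  ultimately have "G N t u v * w (u i) ^ Suc n + G N t (u(i := v)) (u i) * w v ^ Suc n = 0"
    by (simp only: S_def)
  then show ?case unfolding N_def .
qed

text \<open>Multiplying row \<open>i\<close> by its full product of \<open>tu\<close> factors
  cancels the denominator in column \<open>j\<close> and leaves the product over the other
  columns.\<close>

lemma G_regular:
  assumes "\<And>i j. i < n \<Longrightarrow> j < n \<Longrightarrow> tu (t i) (u j) \<noteq> 0"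
  shows "G n t u v = (\<Prod>i<n. \<Prod>j<n. tu (t i) (u j)) * det (mat n n (\<lambda>(i, j). Ps (t i) (u j) v / tu (t i) (u j)))"
proof -
  have "G n t u v = det (mat n n (\<lambda>(i, j). (\<Prod>k<n. tu (t i) (u k)) * (Ps (t i) (u j) v / tu (t i) (u j))))"
    unfolding G_def
  proof (rule det_mat_cong)
    fix i j assume ij: "i < n" "j < n"
    have "(\<Prod>k<n. tu (t i) (u k)) = tu (t i) (u j) * (\<Prod>k\<in>{..<n} - {j}. tu (t i) (u k))"
      by (rule prod.remove) (use ij in auto)
    then show "Ps (t i) (u j) v * (\<Prod>k\<in>{..<n} - {j}. tu (t i) (u k)) =
        (\<Prod>k<n. tu (t i) (u k)) * (Ps (t i) (u j) v / tu (t i) (u j))"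
      using assms[OF ij] by simp
  qed
  then show ?thesis by (simp only: det_mat_scale_rows)
qed

lemma generic_regular: "generic (2 * n + 1) (\<lambda>x. \<Prod>i<n. \<Prod>j<n. tu (x i) (x (n + j)))"
  by (intro generic_prod generic_tu) auto

text \<open>\<open>Ps\<close> and \<open>tu\<close> both change sign when their first two arguments
  are exchanged, so at regular points the determinant of quotients is merely transposed. The sign
  comes from the \<open>n * n\<close> factors \<open>tu\<close>; continuity covers the other
  points.\<close>

lemma G_block_swap:
  assumes "\<And>i. i < n \<Longrightarrow> t i \<noteq> 0 \<and> u i \<noteq> 0" "v \<noteq> 0"
  shows "G n u t v = (- 1) ^ (n * n) * G n t u v"
proof -
  define D where "D x = G n (\<lambda>j. x (n + j)) x (x (2 * n)) - (- 1) ^ (n * n) * G n x (\<lambda>j. x (n + j)) (x (2 * n))" for x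
  have cont: "continuous_on (nonzero_points (2 * n + 1)) D"
    unfolding D_def
    by (intro continuous_on_diff continuous_on_mult continuous_on_const continuous_on_G continuous_on_coordinate)
       (auto simp: nonzero_points_def)
  have van: "D x = 0" if x: "x \<in> nonzero_points (2 * n + 1)" "(\<Prod>i<n. \<Prod>j<n. tu (x i) (x (n + j))) \<noteq> 0" for x
  proof -
    have nz: "x i \<noteq> 0" if "i < 2 * n + 1" for i using x(1) that by (simp add: nonzero_points_def)
    have tn: "tu (x i) (x (n + j)) \<noteq> 0" if "i < n" "j < n" for i j using x(2) that by auto
    have sw: "tu (x (n + j)) (x i) = - tu (x i) (x (n + j))" if "i < n" "j < n" for i j
      using nz that by (intro tu_antisym) auto
    have "G n (\<lambda>j. x (n + j)) x (x (2 * n)) = (\<Prod>i<n. \<Prod>j<n. tu (x (n + i)) (x j)) *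
        det (mat n n (\<lambda>(i, j). Ps (x (n + i)) (x j) (x (2 * n)) / tu (x (n + i)) (x j)))"
      by (rule G_regular) (use sw tn in auto)
    also have "det (mat n n (\<lambda>(i, j). Ps (x (n + i)) (x j) (x (2 * n)) / tu (x (n + i)) (x j))) =
        det (mat n n (\<lambda>(i, j). Ps (x j) (x (n + i)) (x (2 * n)) / tu (x j) (x (n + i))))"
    proof (rule det_mat_cong)
      fix i j assume "i < n" "j < n"
      then show "Ps (x (n + i)) (x j) (x (2 * n)) / tu (x (n + i)) (x j) =
          Ps (x j) (x (n + i)) (x (2 * n)) / tu (x j) (x (n + i))"
        using Psi1_swap12[of "x (n + i)" "x j"] sw[of j i] by simp
    qed
    also have "\<dots> = det (mat n n (\<lambda>(i, j). Ps (x i) (x (n + j)) (x (2 * n)) / tu (x i) (x (n + j))))"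
      by (rule det_mat_transpose)
    also have "(\<Prod>i<n. \<Prod>j<n. tu (x (n + i)) (x j)) = (\<Prod>i<n. \<Prod>j<n. - tu (x j) (x (n + i)))"
      by (intro prod.cong refl) (use sw in auto)
    also have "\<dots> = (\<Prod>j<n. \<Prod>i<n. - 1 * tu (x j) (x (n + i)))"
      by (subst prod.swap) simp
    also have "\<dots> = (- 1) ^ (n * n) * (\<Prod>i<n. \<Prod>j<n. tu (x i) (x (n + j)))"
      by (simp only: prod.distrib) (simp add: power_mult)
    finally show ?thesis
      unfolding D_def using G_regular[of n x "\<lambda>j. x (n + j)", OF tn] by simp
  qed
  define y where "y k = (if k < n then t k else if k < 2 * n then u (k - n) else v)" for k
  have ymem: "y \<in> nonzero_points (2 * n + 1)"
    using assms by (auto simp: nonzero_points_def y_def)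
  have "D y = 0" by (rule generic_imp_eq_0[OF cont generic_regular _ ymem]) (rule van)
  moreover have "G n y (\<lambda>j. y (n + j)) (y (2 * n)) = G n t u v" "G n (\<lambda>j. y (n + j)) y (y (2 * n)) = G n u t v"
    unfolding y_def by (simp, rule G_cong; auto)+
  ultimately show ?thesis by (simp add: D_def)
qed

section \<open>Antisymmetry and comparison with the determinant of a basis\<close>

lemma generic_det_basis:
  assumes \<phi>: "basis_family (V n) m \<phi>"
  shows "generic m (\<lambda>x. det (mat m m (\<lambda>(i, j). \<phi> j (x i))))"
proof -
  have \<phi>V: "\<phi> j \<in> V n" if "j < m" for j using basis_family_in[OF \<phi> that] .
  obtain y where y: "det (mat m m (\<lambda>(i, j). \<phi> j (y i))) \<noteq> 0"
    using basis_family_nodes[OF \<phi>] by blast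
  have "y i \<noteq> 0" if "i < m" for i
  proof
    assume "y i = 0"
    then have "det (mat m m (\<lambda>(i, j). \<phi> j (y i))) = 0"
      using that \<phi>V by (intro det_mat_zero_row[of i]) (auto simp: theta_space_iff)
    with y show False by simp
  qed
  then have "\<exists>x\<in>nonzero_points m. det (mat m m (\<lambda>(i, j). \<phi> j (x i))) \<noteq> 0"
    using y by (auto simp: nonzero_points_def)
  moreover have "(\<lambda>z. det (mat m m (\<lambda>(i, j). \<phi> j ((x(k := z)) i)))) holomorphic_on - {0}" for x k
  proof (rule holomorphic_on_det)
    fix i j assume "i < m" "j < m"
    then show "(\<lambda>z. \<phi> j ((x(k := z)) i)) holomorphic_on - {0}"
      using theta_space_holomorphic[OF \<phi>V[of j]] by (cases "i = k") auto
  qed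
  moreover have "det (mat m m (\<lambda>(i, j). \<phi> j (x i))) = det (mat m m (\<lambda>(i, j). \<phi> j (x' i)))"
    if "\<forall>i<m. x i = x' i" for x x' using that by (intro det_mat_cong) auto
  ultimately show ?thesis unfolding generic_def by blast
qed

lemma continuous_on_det_basis:
  assumes \<phi>: "basis_family (V n) m \<phi>"
  shows "continuous_on (nonzero_points m) (\<lambda>x. det (mat m m (\<lambda>(i, j). \<phi> j (x i))))"
proof (rule continuous_on_det)
  fix i j assume ij: "i < m" "j < m"
  have "continuous_on (- {0}) (\<phi> j)"
    using theta_space_holomorphic[OF basis_family_in[OF \<phi> ij(2)]] by (rule holomorphic_on_imp_continuous_on)
  then show "continuous_on (nonzero_points m) (\<lambda>x. \<phi> j (x i))"
    by (rule continuous_on_compose2[OF _ continuous_on_coordinate]) (use ij in \<open>auto simp: nonzero_points_def\<close>)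
qed

text \<open>The index is lowered by one: this is the function with \<open>Suc n\<close> variables of
  each kind, so the exponent is \<open>n\<close>. No limit is taken, so it has its intended meaning
  only where \<open>w\<close> is nonzero at the last variable.\<close>

definition Psi_quot :: "nat \<Rightarrow> (nat \<Rightarrow> complex) \<Rightarrow> complex" where
  "Psi_quot n x = G (Suc n) x (\<lambda>j. x (Suc n + j)) (x (2 * Suc n)) / w (x (2 * Suc n)) ^ n"

text \<open>Permutations may move any variable to the place of \<open>v\<close>, so \<open>w\<close>
  has to be nonzero at all of them.\<close>

definition W where "W = {z. z \<noteq> 0 \<and> w z \<noteq> 0}"

lemma Psi_quot_cong:
  assumes "\<And>i. i < 2 * Suc n + 1 \<Longrightarrow> x i = x' i"
  shows "Psi_quot n x = Psi_quot n x'"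
proof -
  have "G (Suc n) x (\<lambda>j. x (Suc n + j)) (x (2 * Suc n)) = G (Suc n) x' (\<lambda>j. x' (Suc n + j)) (x (2 * Suc n))"
    by (rule G_cong) (use assms in auto)
  then show ?thesis using assms[of "2 * Suc n"] by (simp add: Psi_quot_def)
qed

section \<open>Antisymmetry of the quotient in all variables\<close>

context
  fixes n :: nat and P :: "(nat \<Rightarrow> complex) set"
  defines "P \<equiv> {x. \<forall>i<2 * Suc n + 1. x i \<in> W}"
begin

lemma P_transpose:
  assumes "x \<in> P" "i < 2 * Suc n + 1" "j < 2 * Suc n + 1"
  shows "x \<circ> Transposition.transpose i j \<in> P"
  using assms by (auto simp: P_def Transposition.transpose_def)

lemma Psi_quot_swap_uv:
  assumes x: "x \<in> P" and i: "i \<le> n"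
  shows "Psi_quot n (x \<circ> Transposition.transpose (Suc n + i) (2 * Suc n)) = - Psi_quot n x"
proof -
  let ?y = "x \<circ> Transposition.transpose (Suc n + i) (2 * Suc n)"
  define u where "u j = x (Suc n + j)" for j
  define v where "v = x (2 * Suc n)"
  have nz: "x k \<noteq> 0" "w (x k) \<noteq> 0" if "k \<le> 2 * Suc n" for k
    using x that by (auto simp: P_def W_def)
  have eq: "G (Suc n) x u v * w (u i) ^ n + G (Suc n) x (u(i := v)) (u i) * w v ^ n = 0"
    by (rule G_swap) (use i nz in \<open>auto simp: u_def v_def\<close>)
  have wn: "w (u i) \<noteq> 0" "w v \<noteq> 0" using nz i by (auto simp: u_def v_def)
  have "?y (2 * Suc n) = u i" by (simp add: u_def)
  moreover have "G (Suc n) ?y (\<lambda>j. ?y (Suc n + j)) (u i) = G (Suc n) x (u(i := v)) (u i)"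
    by (rule G_cong) (use i in \<open>auto simp: Transposition.transpose_def u_def v_def\<close>)
  ultimately have "Psi_quot n ?y = G (Suc n) x (u(i := v)) (u i) / w (u i) ^ n"
    by (simp only: Psi_quot_def)
  also have "\<dots> = - G (Suc n) x u v / w v ^ n"
  proof (subst frac_eq_eq)
    show "G (Suc n) x (u(i := v)) (u i) * w v ^ n = - G (Suc n) x u v * w (u i) ^ n"
      using eq by (simp add: eq_neg_iff_add_eq_0 add.commute)
  qed (use wn in auto)
  also have "\<dots> = - Psi_quot n x"
    by (simp add: Psi_quot_def u_def[abs_def] v_def)
  finally show ?thesis .
qed

text \<open>For a \<open>u\<close> variable this is the exchange with \<open>v\<close>. For a
  \<open>t\<close> variable that exchange is conjugated by the swap of the two blocks, whose sign
  occurs twice and cancels.\<close>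

lemma Psi_quot_transpose_last:
  assumes x: "x \<in> P" and k: "k < 2 * Suc n"
  shows "Psi_quot n (x \<circ> Transposition.transpose k (2 * Suc n)) = - Psi_quot n x"
proof (cases "k < Suc n")
  case False
  then show ?thesis using Psi_quot_swap_uv[OF x, of "k - Suc n"] k by simp
next
  case True
  \<comment> \<open>The involution exchanging the \<open>t\<close> block with the \<open>u\<close>
    block and fixing the place of \<open>v\<close>.\<close>
  define \<beta> where "\<beta> j = (if j < Suc n then j + Suc n else if j < 2 * Suc n then j - Suc n else j)" for j
  have \<beta>: "Psi_quot n (y \<circ> \<beta>) = (- 1) ^ (Suc n * Suc n) * Psi_quot n y" "y \<circ> \<beta> \<in> P" if y: "y \<in> P" for y
  proof -
    have nz: "y k \<noteq> 0" if "k \<le> 2 * Suc n" for k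
      using y that by (auto simp: P_def W_def)
    have "G (Suc n) (y \<circ> \<beta>) (\<lambda>j. (y \<circ> \<beta>) (Suc n + j)) (y (2 * Suc n)) = G (Suc n) (\<lambda>j. y (Suc n + j)) y (y (2 * Suc n))"
      by (rule G_cong) (auto simp: \<beta>_def add.commute)
    also have "\<dots> = (- 1) ^ (Suc n * Suc n) * G (Suc n) y (\<lambda>j. y (Suc n + j)) (y (2 * Suc n))"
      by (rule G_block_swap) (use nz in auto)
    finally have "G (Suc n) (y \<circ> \<beta>) (\<lambda>j. (y \<circ> \<beta>) (Suc n + j)) (y (2 * Suc n)) =
        (- 1) ^ (Suc n * Suc n) * G (Suc n) y (\<lambda>j. y (Suc n + j)) (y (2 * Suc n))" .
    moreover have "(y \<circ> \<beta>) (2 * Suc n) = y (2 * Suc n)" by (simp add: \<beta>_def)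
    ultimately show "Psi_quot n (y \<circ> \<beta>) = (- 1) ^ (Suc n * Suc n) * Psi_quot n y"
      by (simp only: Psi_quot_def times_divide_eq_right)
    show "y \<circ> \<beta> \<in> P" using y by (auto simp: P_def \<beta>_def)
  qed
  let ?\<tau> = "Transposition.transpose (Suc n + k) (2 * Suc n)"
  have "Transposition.transpose k (2 * Suc n) j = \<beta> (?\<tau> (\<beta> j))" for j
    using True unfolding \<beta>_def Transposition.transpose_def
    by (simp split: if_split, arith)
  then have "x \<circ> Transposition.transpose k (2 * Suc n) = ((x \<circ> \<beta>) \<circ> ?\<tau>) \<circ> \<beta>"
    by (simp add: fun_eq_iff)
  then have "Psi_quot n (x \<circ> Transposition.transpose k (2 * Suc n)) = Psi_quot n (((x \<circ> \<beta>) \<circ> ?\<tau>) \<circ> \<beta>)"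
    by (rule arg_cong)
  also have "\<dots> = (- 1) ^ (Suc n * Suc n) * Psi_quot n ((x \<circ> \<beta>) \<circ> ?\<tau>)"
    using True by (intro \<beta> P_transpose x) auto
  also have "Psi_quot n ((x \<circ> \<beta>) \<circ> ?\<tau>) = - Psi_quot n (x \<circ> \<beta>)"
    using True by (intro Psi_quot_swap_uv \<beta> x) auto
  also have "Psi_quot n (x \<circ> \<beta>) = (- 1) ^ (Suc n * Suc n) * Psi_quot n x"
    by (rule \<beta>(1)[OF x])
  finally show ?thesis by (simp add: o_def flip: power_mult_distrib mult.assoc)
qed

text \<open>Two other positions are exchanged by three successive transpositions with the last
  position, giving three sign changes.\<close>

lemma Psi_quot_transpose:
  assumes x: "x \<in> P" and ij: "i < 2 * Suc n + 1" "j < 2 * Suc n + 1" "i \<noteq> j"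
  shows "Psi_quot n (x \<circ> Transposition.transpose i j) = - Psi_quot n x"
proof -
  let ?l = "2 * Suc n"
  consider "j = ?l" "i < ?l" | "i = ?l" "j < ?l" | "i < ?l" "j < ?l" using ij by linarith
  then show ?thesis
  proof cases
    case 1
    then show ?thesis using Psi_quot_transpose_last[OF x] by simp
  next
    case 2
    show ?thesis
      using Psi_quot_transpose_last[OF x 2(2)] unfolding 2(1) transpose_commute[of "2 * Suc n" j] .
  next
    case 3
    have "Transposition.transpose i ?l \<circ> Transposition.transpose ?l j \<circ> Transposition.transpose i ?l = Transposition.transpose i j"
      using 3 ij by (intro transpose_comp_triple) auto
    then have "Psi_quot n (x \<circ> Transposition.transpose i j) =
        Psi_quot n (x \<circ> Transposition.transpose i ?l \<circ> Transposition.transpose j ?l \<circ> Transposition.transpose i ?l)"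
      by (simp only: comp_assoc transpose_commute[of j ?l])
    also have "\<dots> = - Psi_quot n (x \<circ> Transposition.transpose i ?l \<circ> Transposition.transpose j ?l)"
      using 3 by (intro Psi_quot_transpose_last P_transpose x) auto
    also have "Psi_quot n (x \<circ> Transposition.transpose i ?l \<circ> Transposition.transpose j ?l) = - Psi_quot n (x \<circ> Transposition.transpose i ?l)"
      using 3 by (intro Psi_quot_transpose_last P_transpose x) auto
    also have "Psi_quot n (x \<circ> Transposition.transpose i ?l) = - Psi_quot n x"
      using 3 by (intro Psi_quot_transpose_last x) auto
    finally show ?thesis by (simp add: o_def)
  qed
qed

text \<open>Membership is visible in the first \<open>t\<close> variable; antisymmetry carries it to
  every other one, including \<open>v\<close>. The function \<open>f\<close> replaces the quotient,
  which agrees with it on \<open>W\<close>.\<close>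

lemma Psi_quot_in_V:
  assumes x: "x \<in> P" and k: "k < 2 * Suc n + 1"
  obtains f where "f \<in> V (Suc n)" "\<And>z. z \<in> W \<Longrightarrow> Psi_quot n (x(k := z)) = f z"
proof -
  have 0: "\<exists>f\<in>V (Suc n). \<forall>z\<in>W. Psi_quot n (y(0 := z)) = f z" if y: "y \<in> P" for y
  proof -
    define c where "c = inverse (w (y (2 * Suc n)) ^ n)"
    define f where "f = (\<lambda>z. G (Suc n) (y(0 := z)) (\<lambda>j. y (Suc n + j)) (y (2 * Suc n)) * c)"
    have "f \<in> V (Suc n)"
      unfolding f_def using y by (intro theta_space_scale G_in_V) (auto simp: P_def W_def)
    moreover have "Psi_quot n (y(0 := z)) = f z" for z
      by (simp add: Psi_quot_def c_def f_def divide_inverse)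
    ultimately show ?thesis by (intro bexI[of _ f]) auto
  qed
  show ?thesis
  proof (cases "k = 0")
    case True
    then show ?thesis using 0[OF x] that by blast
  next
    case False
    let ?\<tau> = "Transposition.transpose 0 k"
    obtain f where f: "f \<in> V (Suc n)" "\<forall>z\<in>W. Psi_quot n ((x \<circ> ?\<tau>)(0 := z)) = f z"
      using 0[OF P_transpose[OF x _ k]] by auto
    have "Psi_quot n (x(k := z)) = - f z" if z: "z \<in> W" for z
    proof -
      have "x(k := z) \<in> P" using x z by (simp add: P_def)
      then have "Psi_quot n (x(k := z) \<circ> ?\<tau>) = - Psi_quot n (x(k := z))"
        by (rule Psi_quot_transpose) (use k False in auto)
      moreover have "x(k := z) \<circ> ?\<tau> = (x \<circ> ?\<tau>)(0 := z)"
        using False by (auto simp: fun_eq_iff Transposition.transpose_def)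
      ultimately show ?thesis using f(2) z by (metis minus_equation_iff)
    qed
    moreover have "(\<lambda>z. f z * (- 1)) \<in> V (Suc n)" by (rule theta_space_scale[OF f(1)])
    ultimately show ?thesis using that[of "\<lambda>z. f z * (- 1)"] by simp
  qed
qed

text \<open>On \<open>W\<close> the quotient and a multiple of the basis determinant are
  alternating, lie in the span of the basis in each variable and agree at one set of nodes. The form
  cleared of denominators is continuous, so the identity extends to all nonzero points.\<close>

lemma G_eq_det:
  assumes \<phi>: "basis_family (V (Suc n)) (2 * Suc n + 1) \<phi>"
  obtains C where "\<And>x. x \<in> nonzero_points (2 * Suc n + 1) \<Longrightarrow>
    G (Suc n) x (\<lambda>j. x (Suc n + j)) (x (2 * Suc n)) =
      C * det (mat (2 * Suc n + 1) (2 * Suc n + 1) (\<lambda>(i, j). \<phi> j (x i))) * w (x (2 * Suc n)) ^ n"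
proof -
  define m where "m = 2 * Suc n + 1"
  define D where "D x = det (mat m m (\<lambda>(i, j). \<phi> j (x i)))" for x
  have \<phi>': "basis_family (V (Suc n)) m \<phi>" using \<phi> by (simp add: m_def)
  obtain b where b: "b \<noteq> 0" "w b \<noteq> 0" by (rule w_nontrivial)
  have "generic m (\<lambda>x. w (x i))" if "i < m" for i
    using b that holomorphic_w[OF holomorphic_on_ident, of "- {0}"]
    by (intro generic_coordinate[where F = w and b = b]) auto
  then have gw: "generic m (\<lambda>x. \<Prod>i<m. w (x i))"
    by (intro generic_prod) auto
  have "generic m (\<lambda>x. D x * (\<Prod>i<m. w (x i)))"
    unfolding D_def by (rule generic_mult[OF generic_det_basis[OF \<phi>'] gw])
  then obtain y where y: "y \<in> nonzero_points m" "D y \<noteq> 0" "\<forall>i<m. w (y i) \<noteq> 0"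
    by (auto simp: generic_def)
  then have yP: "y \<in> P" by (auto simp: P_def W_def nonzero_points_def m_def)
  \<comment> \<open>Chosen so that the difference of both sides vanishes at the nodes
    \<open>y\<close>.\<close>
  define C where "C = Psi_quot n y / D y"
  have Dperm: "D (x \<circ> Transposition.transpose i j) = - D x" if "i < m" "j < m" "i \<noteq> j" for x i j
    unfolding D_def o_def
    using det_mat_permute_rows[of "Transposition.transpose i j" m "\<lambda>i j. \<phi> j (x i)"] that
    by (simp add: permutes_swap_id sign_swap_id)
  have FD: "Psi_quot n x - C * D x = 0" if x: "x \<in> P" for x
  proof (rule alternating_eq_0[where m = m and X = W and b = \<phi> and y = y and E = "\<lambda>x. Psi_quot n x - C * D x"])
    show "Psi_quot n x - C * D x = Psi_quot n x' - C * D x'" if "\<And>i. i < m \<Longrightarrow> x i = x' i" for x x'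
    proof -
      have "Psi_quot n x = Psi_quot n x'" by (rule Psi_quot_cong) (use that in \<open>auto simp: m_def\<close>)
      moreover have "D x = D x'" unfolding D_def by (rule det_mat_cong) (use that in auto)
      ultimately show ?thesis by simp
    qed
    show "Psi_quot n (x \<circ> Transposition.transpose i j) - C * D (x \<circ> Transposition.transpose i j) = - (Psi_quot n x - C * D x)"
      if "x \<in> {x. \<forall>i<m. x i \<in> W}" "i < m" "j < m" "i \<noteq> j" for x i j
    proof -
      have "x \<in> P" using that(1) unfolding P_def m_def .
      then show ?thesis
        using Psi_quot_transpose[of x i j] Dperm[of i j x] that(2-4) by (simp add: m_def)
    qed
    show "\<exists>a. \<forall>z\<in>W. Psi_quot n (x(k := z)) - C * D (x(k := z)) = (\<Sum>j<m. a j * \<phi> j z)"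
      if "x \<in> {x. \<forall>i<m. x i \<in> W}" and k: "k < m" for x k
    proof -
      have "x \<in> P" using that(1) unfolding P_def m_def .
      then obtain f where f: "f \<in> V (Suc n)" "\<And>z. z \<in> W \<Longrightarrow> Psi_quot n (x(k := z)) = f z"
        using Psi_quot_in_V[of x k] k unfolding m_def by blast
      obtain a where a: "\<And>z. f z = (\<Sum>j<m. a j * \<phi> j z)"
        using basis_family_sum[OF \<phi>' f(1)] by blast
      obtain c where c: "\<And>r. det (mat m m (\<lambda>(i, j). if i = k then r j else \<phi> j (x i))) = (\<Sum>j<m. r j * c j)"
        using det_mat_expand_row[OF k, of "\<lambda>i j. \<phi> j (x i)"] by auto
      have "D (x(k := z)) = det (mat m m (\<lambda>(i, j). if i = k then \<phi> j z else \<phi> j (x i)))" for z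
        unfolding D_def by (rule det_mat_cong) auto
      then have "D (x(k := z)) = (\<Sum>j<m. \<phi> j z * c j)" for z by (simp only: c)
      then have "\<forall>z\<in>W. Psi_quot n (x(k := z)) - C * D (x(k := z)) = (\<Sum>j<m. (a j - C * c j) * \<phi> j z)"
        using f(2) a by (simp add: sum_distrib_left sum_subtractf algebra_simps)
      then show ?thesis by (rule exI[of _ "\<lambda>j. a j - C * c j"])
    qed
    show "y \<in> {x. \<forall>i<m. x i \<in> W}" using yP unfolding P_def m_def .
    show "x \<in> {x. \<forall>i<m. x i \<in> W}" using x unfolding P_def m_def .
    show "Psi_quot n y - C * D y = 0" using y(2) by (simp add: C_def)
    show "det (mat m m (\<lambda>(i, j). \<phi> j (y i))) \<noteq> 0" using y(2) by (simp add: D_def)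
  qed
  define S where "S x = G (Suc n) x (\<lambda>j. x (Suc n + j)) (x (2 * Suc n)) - C * D x * w (x (2 * Suc n)) ^ n" for x
  have "continuous_on (nonzero_points m) S"
    unfolding S_def D_def
    by (intro continuous_on_diff continuous_on_mult continuous_on_const continuous_on_power continuous_on_G
        continuous_on_w continuous_on_coordinate continuous_on_det_basis[OF \<phi>'])
       (auto simp: nonzero_points_def m_def)
  moreover have "S x = 0" if "x \<in> nonzero_points m" "(\<Prod>i<m. w (x i)) \<noteq> 0" for x
  proof -
    have "\<forall>i<m. w (x i) \<noteq> 0" using that(2) by auto
    then have "x \<in> P" using that(1) by (auto simp: P_def W_def nonzero_points_def m_def)
    then have "Psi_quot n x = C * D x" "w (x (2 * Suc n)) \<noteq> 0"
      using FD[of x] by (auto simp: P_def W_def)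
    then show ?thesis by (simp add: S_def Psi_quot_def field_simps)
  qed
  ultimately have "S x = 0" if "x \<in> nonzero_points m" for x
    using generic_imp_eq_0[OF _ gw _ that] by blast
  then show ?thesis using that[of C] by (simp add: S_def D_def m_def)
qed

end

end

section \<open>Values at the removable singularities and the conclusion\<close>

theorem theorem7p3:
  fixes p :: complex and n :: nat and \<psi> \<phi> :: "nat \<Rightarrow> complex \<Rightarrow> complex"
  assumes "0 < norm p" and "norm p < 1" and "n \<ge> 1"
    and "basis_family (theta_space p 1) 3 \<psi>"
    and "basis_family (theta_space p n) (2 * n + 1) \<phi>"
  shows "(\<exists>C. \<forall>x \<in> punctured_points n.
            Psi p \<psi> n x = C * det (mat (2 * n + 1) (2 * n + 1) (\<lambda>(i, j). \<phi> j (x i)))) \<and>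
         (\<forall>\<sigma>. \<sigma> permutes {..<2 * n + 1} \<longrightarrow>
            (\<forall>x \<in> punctured_points n. Psi p \<psi> n (x \<circ> \<sigma>) = of_int (sign \<sigma>) * Psi p \<psi> n x))"
proof -
  interpret nome_basis p \<psi>
    by unfold_locales (use assms in auto)
  define m where "m = 2 * n + 1"
  have pp: "punctured_points n = nonzero_points m"
    by (auto simp: punctured_points_def nonzero_points_def m_def)
  define D where "D x = det (mat m m (\<lambda>(i, j). \<phi> j (x i)))" for x
  have \<phi>: "basis_family (V n) m \<phi>" using assms by (simp add: m_def)
  obtain n' where n': "n = Suc n'" using assms(3) by (cases n) auto
  obtain C where C: "\<And>x. x \<in> nonzero_points m \<Longrightarrow>
      G n x (\<lambda>j. x (n + j)) (x (2 * n)) = C * D x * w (x (2 * n)) ^ (n - 1)"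
    using G_eq_det[of n' \<phi>] assms(5) unfolding n' m_def D_def by auto
  define F where "F y = Psi_formula p \<psi> n y (\<lambda>j. y (n + j)) (y (2 * n))" for y
  \<comment> \<open>Where no denominator vanishes, \<open>G_regular\<close> turns the formula into
    the numerator over a power of \<open>w\<close>, and that power cancels against the one in
    \<open>C\<close>'s defining identity.\<close>
  have reg: "F x = C * D x" if x: "x \<in> regular_points p n" for x
  proof -
    have nz: "w (x (2 * n)) ^ (n - 1) \<noteq> 0" "\<And>i j. i < n \<Longrightarrow> j < n \<Longrightarrow> tu (x i) (x (n + j)) \<noteq> 0"
      and xm: "x \<in> nonzero_points m"
      using x by (auto simp: regular_points_def pp)
    have "F x = G n x (\<lambda>j. x (n + j)) (x (2 * n)) / w (x (2 * n)) ^ (n - 1)"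
      unfolding F_def Psi_formula_def using G_regular[of n x "\<lambda>j. x (n + j)", OF nz(2)] by simp
    then show ?thesis
      using nz(1) by (simp only: C[OF xm] nonzero_mult_div_cancel_right not_False_eq_True)
  qed
  \<comment> \<open>Nonvanishing of this single generic function makes a point regular, so the
    regular points are dense.\<close>
  have gen: "generic m (\<lambda>x. w (x (2 * n)) ^ (n - 1) * (\<Prod>i<n. \<Prod>j<n. tu (x i) (x (n + j))))"
  proof -
    obtain b where b: "b \<noteq> 0" "w b \<noteq> 0" by (rule w_nontrivial)
    have "generic m (\<lambda>x. w (x (2 * n)))"
      using b holomorphic_w[OF holomorphic_on_ident, of "- {0}"]
      by (intro generic_coordinate[where F = w and b = b]) (auto simp: m_def)
    then show ?thesis
      using generic_regular[of n] by (intro generic_mult generic_power) (auto simp: m_def)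
  qed
  have main: "Psi p \<psi> n x = C * D x" if x: "x \<in> nonzero_points m" for x
  proof (cases "x \<in> regular_points p n")
    case True
    then show ?thesis using reg by (simp add: Psi_def F_def Let_def)
  next
    case False
    \<comment> \<open>Nearby regular points differ from \<open>x\<close> because \<open>x\<close> is
      not regular. The filter is therefore nontrivial, and \<open>Lim\<close> returns the limit
      determined by continuity of the determinant.\<close>
    have "x islimpt regular_points p n"
      unfolding islimpt_def
    proof (intro allI impI)
      fix U assume U: "x \<in> U" "open U"
      obtain y where "y \<in> U" "y \<in> nonzero_points m"
        "w (y (2 * n)) ^ (n - 1) * (\<Prod>i<n. \<Prod>j<n. tu (y i) (y (n + j))) \<noteq> 0"
        by (rule generic_dense[OF gen x U(2,1)])
      then have "y \<in> regular_points p n"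
        by (auto simp: regular_points_def pp)
      then show "\<exists>y\<in>regular_points p n. y \<in> U \<and> y \<noteq> x"
        using \<open>y \<in> U\<close> False by blast
    qed
    then have nt: "at x within regular_points p n \<noteq> bot"
      by (simp add: trivial_limit_within)
    have "continuous_on (nonzero_points m) (\<lambda>x. C * D x)"
      unfolding D_def by (intro continuous_on_mult continuous_on_const continuous_on_det_basis[OF \<phi>])
    then have "((\<lambda>x. C * D x) \<longlongrightarrow> C * D x) (at x within nonzero_points m)"
      using x by (simp add: continuous_on_def)
    then have "((\<lambda>x. C * D x) \<longlongrightarrow> C * D x) (at x within regular_points p n)"
      by (rule tendsto_within_subset) (auto simp: regular_points_def pp)
    moreover have "\<forall>\<^sub>F y in at x within regular_points p n. C * D y = F y"
      by (auto simp: eventually_at_filter reg)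
    ultimately have "(F \<longlongrightarrow> C * D x) (at x within regular_points p n)"
      by (rule Lim_transform_eventually)
    then have "Lim (at x within regular_points p n) F = C * D x"
      by (rule tendsto_Lim[OF nt])
    then show ?thesis using False by (simp add: Psi_def F_def[abs_def] Let_def)
  qed
  have perm: "Psi p \<psi> n (x \<circ> \<sigma>) = of_int (sign \<sigma>) * Psi p \<psi> n x"
    if \<sigma>: "\<sigma> permutes {..<m}" and x: "x \<in> nonzero_points m" for \<sigma> x
  proof -
    have "x \<circ> \<sigma> \<in> nonzero_points m"
      using x permutes_in_image[OF \<sigma>] by (auto simp: nonzero_points_def)
    moreover have "D (x \<circ> \<sigma>) = of_int (sign \<sigma>) * D x"
      unfolding D_def o_def using det_mat_permute_rows[OF \<sigma>, of "\<lambda>i j. \<phi> j (x i)"] .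
    ultimately show ?thesis using main x by simp
  qed
  show ?thesis
    using main perm unfolding pp D_def m_def by blast
qed

end
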